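(* Let $t_0\in\mathbb{R}$, $a>0$, $J=[t_0,t_0+a]$, and let $g:J\to\mathbb{R}$ be nondecreasing and left-continuous. Let $h,f:J\times\mathbb{R}^n\to\mathbb{R}^n$ be functions, $x_0\in\mathbb{R}^n$, where $f(t,\cdot)$ is continuous for every $t\in J$ and $f(\cdot,u)$ is Kurzweil--Stieltjes integrable with respect to $g$ on $J$ for every $u\in\mathbb{R}^n$. For each $k\in\mathbb{N}$ let $h_k,f_k:J\times\mathbb{R}^n\to\mathbb{R}^n$, $\varphi_k:[0,\infty)\to[0,\infty)$ and $M_k:J\to[0,\infty)$ be functions such that: (A0) For every $t\in J$, $f_k(t,\cdot)$ is continuous. (A1) For every $u\in\mathbb{R}^n$, $f_k(\cdot,u)$ is Kurzweil--Stieltjes integrable with respect to $g$ on $J$. (A2) $M_k$ is Kurzweil--Stieltjes integrable with respect to $g$ on $J$ and $\left\|\int_c^d f_k(s,u)\,\mathrm{d}g(s)\right\|\le\int_c^d M_k(s)\,\mathrm{d}g(s)$ for all $u\in\mathbb{R}^n$ and $[c,d]\subseteq J$. (A3) For every $v\in\mathbb{R}^n$, $h_k(\cdot,v)$ is regulated on $J$, and $\varphi_k$ is a $\mathfrak{D}$-function with $\varphi_k(t)<t$ for all $t>0$ such that $\|h_k(t,u)-h_k(t,v)\|\le\varphi_k(\|u-v\|)$ for all $u,v\in\mathbb{R}^n$ and $t\in J$. Assume also: (I) For every $0<c<d$ there is $\delta>0$ such that $\varphi_k(t)<t-\delta$ for all $t\in[c,d]$ and all $k\in\mathbb{N}$.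 For each $k\in\mathbb{N}$ let $\widehat{x}_k\in\mathbb{R}^n$ and let $x_k(\cdot)$ be a solution of $$x_k(t)=x_k(t_0)-h_k(t_0,x_k(t_0))+h_k(t,x_k(t))+\int_{t_0}^t f_k(s,x_k(s))\,\mathrm{d}g(s),\quad t\in J,\qquad x_k(t_0)=\widehat{x}_k .$$ Assume that the following conditions are fulfilled: (i) $\widehat{x}_k\to x_0$ as $k\to\infty$. (ii) $h_k(t,u)\to h(t,u)$ as $k\to\infty$, uniformly for $t\in J$ and $u$ in bounded subsets of $\mathbb{R}^n$. (iii) $f_k(t,u)\to f(t,u)$ as $k\to\infty$ for each $t\in J$ and uniformly for $u$ in bounded subsets of $\mathbb{R}^n$; the sequence $(M_k)_k$ converges pointwise on $J$ to a function $M:J\to[0,\infty)$; and there exists a constant $C>0$ such that for every subdivision $\{\sigma_0,\dots,\sigma_l\}$ of the interval $J$ and every finite subset $\{m_1,\dots,m_l\}$ of $\mathbb{N}$ the inequality $\sum_{j=1}^l\int_{\sigma_{j-1}}^{\sigma_j}M_{m_j}(s)\,\mathrm{d}g(s)\le C$ holds. If there exists $R>0$ such that $$\liminf_{k\to\infty}\ \sup_{r\ge R}\frac{\varphi_k(r)}{r}<1,$$ then there is a subsequence of $(x_k)_k$ that converges uniformly on $J$ to a solution $x(\cdot)$ of the problem $$x(t)=x_0-h(t_0,x(t_0))+h(t,x(t))+\int_{t_0}^t f(s,x(s))\,\mathrm{d}g(s),\quad t\in J,\qquad x(t_0)=x_0 .$$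
   Context: $\mathbb{R}^n$ carries a norm $\|\cdot\|$. A function $x:[a,b]\to X$ ($X$ a Banach space) is regulated if the one-sided limit $x(t^-)$ exists for every $t\in(a,b]$ and $x(t^+)$ exists for every $t\in[a,b)$. A subdivision of $J$ is a set of points $t_0=\sigma_0<\sigma_1<\dots<\sigma_l=t_0+a$. Kurzweil--Stieltjes integral: a gauge on $[a,b]$ is a function $\delta:[a,b]\to(0,\infty)$. A tagged partition $a=s_0\le s_1\le\dots\le s_k=b$ with tags $\tau_i\in[s_{i-1},s_i]$ is $\delta$-fine if $[s_{i-1},s_i]\subset(\tau_i-\delta(\tau_i),\tau_i+\delta(\tau_i))$ for all $i$. A function $f:[a,b]\to\mathbb{R}^n$ is Kurzweil--Stieltjes integrable with respect to $g:[a,b]\to\mathbb{R}$ if there is $\mathcal{I}\in\mathbb{R}^n$ such that for every $\varepsilon>0$ there is a gauge $\delta$ on $[a,b]$ with $\left\|\sum_{i=1}^k f(\tau_i)(g(s_i)-g(s_{i-1}))-\mathcal{I}\right\|<\varepsilon$ for all $\delta$-fine tagged partitions of $[a,b]$; then $\int_a^b f\,\mathrm{d}g:=\mathcal{I}$. All integrals are in this sense. A $\mathfrak{D}$-function is a continuous nondecreasing function $\psi:[0,\infty)\to[0,\infty)$ with $\psi(0)=0$ and $\psi(s)>0$ for $s>0$. A solution of such a problem (with data $h,f,x_0$, respectively $h_k,f_k,\widehat{x}_k$) is a regulated function $x:J\to\mathbb{R}^n$ such that $t\mapsto h(t,x(t))$ (respectively $t\mapsto h_k(t,x(t))$) is regulated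 on $J$, the integral equation holds for all $t\in J$ (with the integral existing in the Kurzweil--Stieltjes sense), and the initial condition holds. *)

theory Defs
  imports "HOL-Analysis.Analysis"
begin

text \<open>
  The space \<open>\<real>\<^sup>n\<close> is \<^typ>\<open>real ^ 'n\<close> together with an explicit, arbitrary norm. Purely
  topological notions (continuity, one-sided limits, boundedness, uniform convergence) are the
  library's: they do not depend on the choice of the norm on a finite-dimensional space.
\<close>

definition is_norm :: "('a::real_vector \<Rightarrow> real) \<Rightarrow> bool" where
  "is_norm N \<longleftrightarrow>
     (\<forall>v. 0 \<le> N v) \<and> (\<forall>v. N v = 0 \<longleftrightarrow> v = 0) \<and>
     (\<forall>c v. N (c *\<^sub>R v) = \<bar>c\<bar> * N v) \<and> (\<forall>u v. N (u + v) \<le> N u + N v)"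

definition regulated_on :: "real \<Rightarrow> real \<Rightarrow> (real \<Rightarrow> 'a::topological_space) \<Rightarrow> bool" where
  "regulated_on a b x \<longleftrightarrow>
     (\<forall>t\<in>{a<..b}. \<exists>l. (x \<longlongrightarrow> l) (at_left t)) \<and>
     (\<forall>t\<in>{a..<b}. \<exists>l. (x \<longlongrightarrow> l) (at_right t))"

definition gauge_on :: "real \<Rightarrow> real \<Rightarrow> (real \<Rightarrow> real) \<Rightarrow> bool" where
  "gauge_on a b \<delta> \<longleftrightarrow> (\<forall>t\<in>{a..b}. 0 < \<delta> t)"

definition tagged_partition ::
  "real \<Rightarrow> real \<Rightarrow> nat \<Rightarrow> (nat \<Rightarrow> real) \<Rightarrow> (nat \<Rightarrow> real) \<Rightarrow> bool" where
  "tagged_partition a b k s \<tau> \<longleftrightarrow>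
     s 0 = a \<and> s k = b \<and> (\<forall>i\<in>{1..k}. s (i - 1) \<le> s i \<and> \<tau> i \<in> {s (i - 1)..s i})"

definition fine_partition ::
  "(real \<Rightarrow> real) \<Rightarrow> nat \<Rightarrow> (nat \<Rightarrow> real) \<Rightarrow> (nat \<Rightarrow> real) \<Rightarrow> bool" where
  "fine_partition \<delta> k s \<tau> \<longleftrightarrow>
     (\<forall>i\<in>{1..k}. {s (i - 1)..s i} \<subseteq> {\<tau> i - \<delta> (\<tau> i)<..<\<tau> i + \<delta> (\<tau> i)})"

text \<open>
  The Kurzweil--Stieltjes integral over \<open>[a, b]\<close>, for \<open>a \<le> b\<close>. The first argument is the norm on
  the range of the integrand (\<^const>\<open>abs\<close> for real-valued integrands).
\<close>

definition has_KS_integral ::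
  "('a::real_vector \<Rightarrow> real) \<Rightarrow> (real \<Rightarrow> 'a) \<Rightarrow> (real \<Rightarrow> real) \<Rightarrow> real \<Rightarrow> real \<Rightarrow> 'a \<Rightarrow> bool" where
  "has_KS_integral N f g a b I \<longleftrightarrow>
     (\<forall>\<epsilon>>0. \<exists>\<delta>. gauge_on a b \<delta> \<and>
        (\<forall>k s \<tau>. tagged_partition a b k s \<tau> \<and> fine_partition \<delta> k s \<tau> \<longrightarrow>
           N ((\<Sum>i=1..k. (g (s i) - g (s (i - 1))) *\<^sub>R f (\<tau> i)) - I) < \<epsilon>))"

definition KS_integrable ::
  "('a::real_vector \<Rightarrow> real) \<Rightarrow> (real \<Rightarrow> 'a) \<Rightarrow> (real \<Rightarrow> real) \<Rightarrow> real \<Rightarrow> real \<Rightarrow> bool" where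
  "KS_integrable N f g a b \<longleftrightarrow> (\<exists>I. has_KS_integral N f g a b I)"

definition KS_integral ::
  "('a::real_vector \<Rightarrow> real) \<Rightarrow> (real \<Rightarrow> 'a) \<Rightarrow> (real \<Rightarrow> real) \<Rightarrow> real \<Rightarrow> real \<Rightarrow> 'a" where
  "KS_integral N f g a b = (THE I. has_KS_integral N f g a b I)"

definition D_function :: "(real \<Rightarrow> real) \<Rightarrow> bool" where
  "D_function \<psi> \<longleftrightarrow>
     (\<forall>s\<ge>0. 0 \<le> \<psi> s) \<and> continuous_on {0..} \<psi> \<and> mono_on {0..} \<psi> \<and>
     \<psi> 0 = 0 \<and> (\<forall>s>0. 0 < \<psi> s)"

text \<open>
  Solutions on \<open>J = [t\<^sub>0, t\<^sub>0 + a]\<close>. In view of the initial condition, the leading term of the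
  integral equation may be read as either \<open>x\<^sub>0\<close> or \<open>x t\<^sub>0\<close>.
\<close>

definition is_solution ::
  "('a::{real_vector, topological_space} \<Rightarrow> real) \<Rightarrow> (real \<Rightarrow> real) \<Rightarrow> real \<Rightarrow> real \<Rightarrow>
   (real \<Rightarrow> 'a \<Rightarrow> 'a) \<Rightarrow> (real \<Rightarrow> 'a \<Rightarrow> 'a) \<Rightarrow> 'a \<Rightarrow> (real \<Rightarrow> 'a) \<Rightarrow> bool" where
  "is_solution N g t0 a h f x0 x \<longleftrightarrow>
     regulated_on t0 (t0 + a) x \<and>
     regulated_on t0 (t0 + a) (\<lambda>t. h t (x t)) \<and>
     (\<forall>t\<in>{t0..t0 + a}.
        KS_integrable N (\<lambda>s. f s (x s)) g t0 t \<and>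
        x t = x0 - h t0 (x t0) + h t (x t) + KS_integral N (\<lambda>s. f s (x s)) g t0 t) \<and>
     x t0 = x0"

definition subdivision :: "real \<Rightarrow> real \<Rightarrow> nat \<Rightarrow> (nat \<Rightarrow> real) \<Rightarrow> bool" where
  "subdivision a b l \<sigma> \<longleftrightarrow>
     \<sigma> 0 = a \<and> \<sigma> l = b \<and> (\<forall>j\<in>{1..l}. \<sigma> (j - 1) < \<sigma> j)"

end

theory Submission
  imports Defs "HOL-Complex_Analysis.Great_Picard"
begin

text \<open>
  Why the theorem holds. Let \<open>y k t\<close> be the integral of \<open>fk k s (xk k s)\<close> from \<open>t0\<close> to \<open>t\<close>.

  \<^item> The bound on the sums over subdivisions with a free choice of index yields one function
  \<open>K\<close> whose increments dominate the integrals of all \<open>Mk k\<close>, hence all integrals of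
  \<open>fk k s u\<close> with \<open>u\<close> fixed (lemma \<open>common_majorant\<close>). The same increments then dominate the integrals
  along the curves \<open>s \<mapsto> xk k s\<close>, because at every tag \<open>u\<close> can be chosen from a countable dense set
  (lemma \<open>KS_integral_superposition_bound\<close>). So \<open>\<parallel>y k t - y k s\<parallel> \<le> K t - K s\<close> for
  \<open>s \<le> t\<close> and all \<open>k\<close>, and a subsequence of the \<open>y k\<close> converges uniformly (lemma
  \<open>equivariation_subsequence\<close>).

  \<^item> The slope condition on \<open>\<phi> k\<close> at infinity bounds the solutions along a subsequence. Then
  \<open>xk k t\<close> is the fixed point of \<open>u \<mapsto> w k t + hk k t u\<close>, with \<open>w k\<close> uniformly convergent
  and the maps \<open>hk k t\<close> contracting with a gap that does not depend on \<open>k\<close>; this makes the \<open>xk k\<close> uniformly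
  Cauchy (lemma \<open>fixed_points_uniform_limit\<close>).

  \<^item> In the limit, the integral passes through by a dominated convergence theorem in which the
  majorant is the interval function \<open>K v - K u\<close> (lemma \<open>KS_dominated_convergence\<close>).

  The last item is the core of the work. It is proved with gauges alone. For a
  dominated family \<open>H i\<close> with shrinking index sets \<open>S p\<close> such that \<open>H i t\<close> becomes small for
  \<open>i \<in> S p\<close> at every single \<open>t\<close>, the joint variation of the indefinite integrals tends to zero (lemma
  \<open>variation_vanishes\<close>); apply this to the differences of the members of the sequence. Both this
  lemma and the bound along curves need a different function at each tag, and
  the Saks--Henstock lemma for countable families makes that possible with one gauge.

  All norms on \<open>\<real>\<^sup>n\<close> being equivalent, integrals are taken with respect to the standard norm, while
  the contraction estimates use the given one.
\<close>

section \<open>Tagged partitions as lists\<close>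

text \<open>Partitions are lists of triples (left end point, tag, right end point): concatenation and
  induction are then those of lists, which indexed families \<open>s\<close>, \<open>\<tau>\<close> do not offer.\<close>

fun tagged_chain :: "real \<Rightarrow> real \<Rightarrow> (real \<times> real \<times> real) list \<Rightarrow> bool" where
  "tagged_chain a b [] \<longleftrightarrow> a = b"
| "tagged_chain a b ((u, t, v) # xs) \<longleftrightarrow> u = a \<and> u \<le> t \<and> t \<le> v \<and> tagged_chain v b xs"

definition fine_at :: "(real \<Rightarrow> real) \<Rightarrow> real \<times> real \<times> real \<Rightarrow> bool" where
  "fine_at \<delta> x \<longleftrightarrow> (case x of (u, t, v) \<Rightarrow> t - \<delta> t < u \<and> v < t + \<delta> t)"

definition stieltjes_sum ::
  "(real \<Rightarrow> real) \<Rightarrow> (real \<Rightarrow> 'a::real_vector) \<Rightarrow> (real \<times> real \<times> real) list \<Rightarrow> 'a" where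
  "stieltjes_sum g f xs = (\<Sum>(u, t, v)\<leftarrow>xs. (g v - g u) *\<^sub>R f t)"

lemma stieltjes_sum_simps [simp]:
  "stieltjes_sum g f [] = 0"
  "stieltjes_sum g f ((u, t, v) # xs) = (g v - g u) *\<^sub>R f t + stieltjes_sum g f xs"
  "stieltjes_sum g f (xs @ ys) = stieltjes_sum g f xs + stieltjes_sum g f ys"
  by (simp_all add: stieltjes_sum_def)

lemma tagged_chain_append:
  "tagged_chain a c xs \<Longrightarrow> tagged_chain c b ys \<Longrightarrow> tagged_chain a b (xs @ ys)"
  by (induction a c xs rule: tagged_chain.induct) auto

lemma tagged_chain_snoc:
  "tagged_chain a b (xs @ [(u, t, v)]) \<longleftrightarrow> tagged_chain a u xs \<and> u \<le> t \<and> t \<le> v \<and> v = b"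
  by (induction a u xs rule: tagged_chain.induct) auto

lemma tagged_chain_le: "tagged_chain a b xs \<Longrightarrow> a \<le> b"
  by (induction a b xs rule: tagged_chain.induct) auto

lemma tagged_chain_mem:
  assumes "tagged_chain a b xs" "(u, t, v) \<in> set xs"
  shows "a \<le> u" "u \<le> t" "t \<le> v" "v \<le> b"
  using assms
  by (induction a b xs rule: tagged_chain.induct; force dest: tagged_chain_le)+

definition fine_chain :: "(real \<Rightarrow> real) \<Rightarrow> real \<Rightarrow> real \<Rightarrow> (real \<times> real \<times> real) list \<Rightarrow> bool" where
  "fine_chain \<delta> a b xs \<longleftrightarrow> tagged_chain a b xs \<and> (\<forall>x\<in>set xs. fine_at \<delta> x)"

lemma fine_chain_append:
  "fine_chain \<delta> a c xs \<Longrightarrow> fine_chain \<delta> c b ys \<Longrightarrow> fine_chain \<delta> a b (xs @ ys)"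
  by (auto simp: fine_chain_def intro: tagged_chain_append)

lemma fine_at_min:
  assumes "fine_at (\<lambda>t. min (\<delta> t) (\<delta>' t)) x"
  shows "fine_at \<delta> x" "fine_at \<delta>' x"
  using assms by (auto simp: fine_at_def split: prod.splits)

lemma fine_chain_min:
  assumes "fine_chain (\<lambda>t. min (\<delta> t) (\<delta>' t)) a b xs"
  shows "fine_chain \<delta> a b xs" "fine_chain \<delta>' a b xs"
  using assms fine_at_min unfolding fine_chain_def by blast+

lemma tagged_partition_imp_chain:
  "tagged_partition a b k s \<tau> \<Longrightarrow>
     tagged_chain a b (map (\<lambda>i. (s (i - 1), \<tau> i, s i)) [1..<Suc k])"
proof (induction k arbitrary: b)
  case 0
  then show ?case by (simp add: tagged_partition_def)
next
  case (Suc k)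
  have "tagged_partition a (s k) k s \<tau>" and "s k \<le> \<tau> (Suc k)" "\<tau> (Suc k) \<le> s (Suc k)" "s (Suc k) = b"
    using Suc.prems unfolding tagged_partition_def by (force+)
  with Suc.IH[of "s k"] show ?case
    by (simp add: tagged_chain_snoc)
qed

lemma chain_imp_tagged_partition:
  "tagged_chain a b xs \<Longrightarrow>
     \<exists>s \<tau>. tagged_partition a b (length xs) s \<tau> \<and>
           xs = map (\<lambda>i. (s (i - 1), \<tau> i, s i)) [1..<Suc (length xs)]"
proof (induction xs arbitrary: b rule: rev_induct)
  case Nil
  then show ?case by (auto simp: tagged_partition_def)
next
  case (snoc x xs)
  obtain u t v where x: "x = (u, t, v)" by (cases x)
  let ?k = "length xs"
  have ch: "tagged_chain a u xs" "u \<le> t" "t \<le> v" "v = b"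
    using snoc.prems by (auto simp: x tagged_chain_snoc)
  obtain s \<tau> where s: "tagged_partition a u ?k s \<tau>"
    and xs: "xs = map (\<lambda>i. (s (i - 1), \<tau> i, s i)) [1..<Suc ?k]"
    using snoc.IH[OF ch(1)] by blast
  define s' where "s' = s(Suc ?k := b)"
  define \<tau>' where "\<tau>' = \<tau>(Suc ?k := t)"
  have "tagged_partition a b (length (xs @ [x])) s' \<tau>'"
    using s ch unfolding tagged_partition_def s'_def \<tau>'_def
    by (auto simp: le_Suc_eq)
  moreover have "xs @ [x] = map (\<lambda>i. (s' (i - 1), \<tau>' i, s' i)) [1..<Suc (length (xs @ [x]))]"
  proof -
    have "[1..<Suc (length (xs @ [x]))] = [1..<Suc ?k] @ [Suc ?k]" by simp
    moreover have "map (\<lambda>i. (s' (i - 1), \<tau>' i, s' i)) [1..<Suc ?k] = xs"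
      by (rule trans[OF _ xs[symmetric]]) (auto simp: s'_def \<tau>'_def simp del: upt_Suc)
    moreover have "s ?k = u" using s by (auto simp: tagged_partition_def)
    ultimately show ?thesis using ch by (simp add: x s'_def \<tau>'_def del: upt_Suc)
  qed
  ultimately show ?case by blast
qed

lemma fine_partition_iff_chain:
  assumes "tagged_partition a b k s \<tau>"
  shows "fine_partition \<delta> k s \<tau> \<longleftrightarrow>
    (\<forall>x\<in>set (map (\<lambda>i. (s (i - 1), \<tau> i, s i)) [1..<Suc k]). fine_at \<delta> x)"
proof -
  have "{s (i - 1)..s i} \<subseteq> {\<tau> i - \<delta> (\<tau> i)<..<\<tau> i + \<delta> (\<tau> i)} \<longleftrightarrow>
        fine_at \<delta> (s (i - 1), \<tau> i, s i)" if "i \<in> {1..k}" for i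
  proof -
    have "s (i - 1) \<le> s i" using assms that by (auto simp: tagged_partition_def)
    then show ?thesis by (auto simp: fine_at_def subset_eq)
  qed
  then show ?thesis
    unfolding fine_partition_def by (simp add: atLeastLessThanSuc_atLeastAtMost del: upt_Suc)
qed

lemma stieltjes_sum_partition:
  "stieltjes_sum g f (map (\<lambda>i. (s (i - 1), \<tau> i, s i)) [1..<Suc k])
     = (\<Sum>i=1..k. (g (s i) - g (s (i - 1))) *\<^sub>R f (\<tau> i))"
  unfolding stieltjes_sum_def
  by (simp add: o_def interv_sum_list_conv_sum_set_nat atLeastLessThanSuc_atLeastAtMost del: upt_Suc)

text \<open>Besides the change from indexed partitions to lists, gauges become positive on the whole real
  line; as all tags lie in \<open>[a, b]\<close>, this changes nothing.\<close>

lemma has_KS_integral_iff_chain: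
  "has_KS_integral N f g a b I \<longleftrightarrow>
     (\<forall>\<epsilon>>0. \<exists>\<delta>. (\<forall>t. 0 < \<delta> t) \<and>
        (\<forall>xs. fine_chain \<delta> a b xs \<longrightarrow>
           N (stieltjes_sum g f xs - I) < \<epsilon>))" (is "?L \<longleftrightarrow> ?R")
proof
  assume L: ?L
  show ?R
  proof (intro allI impI)
    fix \<epsilon> :: real assume "\<epsilon> > 0"
    then obtain \<delta> where d: "gauge_on a b \<delta>"
      and sm0: "\<forall>k s \<tau>. tagged_partition a b k s \<tau> \<and> fine_partition \<delta> k s \<tau> \<longrightarrow>
           N ((\<Sum>i=1..k. (g (s i) - g (s (i - 1))) *\<^sub>R f (\<tau> i)) - I) < \<epsilon>"
      using L unfolding has_KS_integral_def by auto
    note sm = sm0[rule_format, OF conjI]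
    define \<delta>' where "\<delta>' = (\<lambda>t. if t \<in> {a..b} then \<delta> t else 1)"
    have "N (stieltjes_sum g f xs - I) < \<epsilon>"
      if fc: "fine_chain \<delta>' a b xs" for xs
    proof -
      have ch: "tagged_chain a b xs" and fi: "\<forall>x\<in>set xs. fine_at \<delta>' x"
        using fc by (auto simp: fine_chain_def)
      have fi': "\<forall>x\<in>set xs. fine_at \<delta> x"
      proof
        fix x assume x: "x \<in> set xs"
        obtain u t v where xx: "x = (u, t, v)" by (cases x)
        have "t \<in> {a..b}" using tagged_chain_mem[OF ch x[unfolded xx]] by auto
        then show "fine_at \<delta> x" using fi x by (auto simp: xx fine_at_def \<delta>'_def)
      qed
      obtain s \<tau> where s: "tagged_partition a b (length xs) s \<tau>"
        and xs: "xs = map (\<lambda>i. (s (i - 1), \<tau> i, s i)) [1..<Suc (length xs)]"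
        using chain_imp_tagged_partition[OF ch] by blast
      have "fine_partition \<delta> (length xs) s \<tau>"
        unfolding fine_partition_iff_chain[OF s] using fi' xs by metis
      from sm[OF s this] show ?thesis
        unfolding stieltjes_sum_partition[symmetric] using xs by metis
    qed
    moreover have "\<forall>t. 0 < \<delta>' t" using d by (auto simp: \<delta>'_def gauge_on_def)
    ultimately show "\<exists>\<delta>. (\<forall>t. 0 < \<delta> t) \<and>
        (\<forall>xs. fine_chain \<delta> a b xs \<longrightarrow>
           N (stieltjes_sum g f xs - I) < \<epsilon>)" by blast
  qed
next
  assume R: ?R
  show ?L
    unfolding has_KS_integral_def
  proof (intro allI impI)
    fix \<epsilon> :: real assume "\<epsilon> > 0"
    then obtain \<delta> where d: "\<forall>t. 0 < \<delta> t"
      and sm: "\<And>xs. fine_chain \<delta> a b xs \<Longrightarrow>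
           N (stieltjes_sum g f xs - I) < \<epsilon>"
      using R by blast
    show "\<exists>\<delta>. gauge_on a b \<delta> \<and>
        (\<forall>k s \<tau>. tagged_partition a b k s \<tau> \<and> fine_partition \<delta> k s \<tau> \<longrightarrow>
           N ((\<Sum>i=1..k. (g (s i) - g (s (i - 1))) *\<^sub>R f (\<tau> i)) - I) < \<epsilon>)"
    proof (intro exI[of _ \<delta>] conjI allI impI, goal_cases)
      case 1 then show ?case using d by (simp add: gauge_on_def)
    next
      case (2 k s \<tau>)
      then show ?case
        using sm[of "map (\<lambda>i. (s (i - 1), \<tau> i, s i)) [1..<Suc k]"] tagged_partition_imp_chain[of a b k s \<tau>] fine_partition_iff_chain[of a b k s \<tau> \<delta>]
          stieltjes_sum_partition[of g f s \<tau> k] by (auto simp: fine_chain_def simp del: upt_Suc)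
    qed
  qed
qed

text \<open>Cousin's lemma.\<close>

lemma fine_chain_exists:
  assumes "a \<le> b" "\<And>t. 0 < \<delta> t"
  shows "\<exists>xs. fine_chain \<delta> a b xs"
  using assms(1)
proof (induction rule: Bolzano)
  case (trans a b c)
  then obtain xs ys where
    "fine_chain \<delta> a b xs" "fine_chain \<delta> b c ys"
    by blast
  then show ?case by (blast intro: fine_chain_append)
next
  case (local t)
  show ?case
  proof (intro exI[of _ "\<delta> t"] conjI allI impI)
    fix u v assume "u \<le> t \<and> t \<le> v \<and> v - u < \<delta> t"
    then show "\<exists>xs. fine_chain \<delta> u v xs"
      by (intro exI[of _ "[(u, t, v)]"]) (auto simp: fine_at_def fine_chain_def)
  qed (use assms in auto)
qed

section \<open>Elementary properties of the Kurzweil--Stieltjes integral\<close>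

abbreviation "KS_int g f \<equiv> KS_integral norm f g"
abbreviation "KS_on g f \<equiv> KS_integrable norm f g"

lemma has_KS_integral_gauge:
  assumes "has_KS_integral N f g a b I" "\<epsilon> > 0"
  obtains \<delta> where "\<And>t. 0 < \<delta> t"
    "\<And>xs. fine_chain \<delta> a b xs \<Longrightarrow> N (stieltjes_sum g f xs - I) < \<epsilon>"
  using assms unfolding has_KS_integral_iff_chain by blast

lemma has_KS_integral_unique:
  fixes f :: "real \<Rightarrow> 'a::euclidean_space"
  assumes ab: "a \<le> b" and I: "has_KS_integral norm f g a b I" and J: "has_KS_integral norm f g a b J"
  shows "I = J"
proof (rule ccontr)
  assume "I \<noteq> J"
  then have e: "dist I J / 2 > 0" by simp
  obtain \<delta> where d: "\<And>t. 0 < \<delta> t" "\<And>xs. fine_chain \<delta> a b xs \<Longrightarrow>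
      norm (stieltjes_sum g f xs - I) < dist I J / 2"
    using has_KS_integral_gauge[OF I e] by blast
  obtain \<delta>' where d': "\<And>t. 0 < \<delta>' t" "\<And>xs. fine_chain \<delta>' a b xs \<Longrightarrow>
      norm (stieltjes_sum g f xs - J) < dist I J / 2"
    using has_KS_integral_gauge[OF J e] by blast
  obtain xs where "fine_chain (\<lambda>t. min (\<delta> t) (\<delta>' t)) a b xs"
    using fine_chain_exists[OF ab, of "\<lambda>t. min (\<delta> t) (\<delta>' t)"] d d' by auto
  then have "norm (stieltjes_sum g f xs - I) < dist I J / 2" "norm (stieltjes_sum g f xs - J) < dist I J / 2"
    using d d' fine_chain_min by blast+
  then show False
    by (metis dist_commute dist_norm dist_triangle_half_r less_irrefl)
qed

lemma KS_integral_eqI: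
  fixes f :: "real \<Rightarrow> 'a::euclidean_space"
  assumes "a \<le> b" "has_KS_integral norm f g a b I"
  shows "KS_int g f a b = I"
  unfolding KS_integral_def using assms has_KS_integral_unique by blast

lemma has_KS_integral_KS_integral:
  fixes f :: "real \<Rightarrow> 'a::euclidean_space"
  assumes "a \<le> b" "KS_on g f a b"
  shows "has_KS_integral norm f g a b (KS_int g f a b)"
  using assms KS_integral_eqI unfolding KS_integrable_def by metis

lemma KS_integral_refl [simp]:
  fixes f :: "real \<Rightarrow> 'a::euclidean_space"
  shows "KS_int g f a a = 0"
proof (rule KS_integral_eqI)
  have "stieltjes_sum g f xs = 0" if "tagged_chain a' b xs" "a' = b" for xs a' b
    using that
  proof (induction a' b xs rule: tagged_chain.induct)
    case (2 a b u t v xs)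
    then have "v = b" "u = v" using tagged_chain_le[of v b xs] by auto
    with 2 show ?case by auto
  qed simp
  then show "has_KS_integral norm f g a a 0"
    by (auto simp: has_KS_integral_iff_chain fine_chain_def intro!: exI[of _ "\<lambda>_. 1"])
qed simp

lemma KS_integrable_Cauchy:
  fixes f :: "real \<Rightarrow> 'a::euclidean_space"
  assumes ab: "a \<le> b"
  shows "KS_on g f a b \<longleftrightarrow> (\<forall>\<epsilon>>0. \<exists>\<delta>. (\<forall>t. 0 < \<delta> t) \<and>
     (\<forall>xs ys. fine_chain \<delta> a b xs \<and>
              fine_chain \<delta> a b ys \<longrightarrow>
        norm (stieltjes_sum g f xs - stieltjes_sum g f ys) < \<epsilon>))" (is "?L \<longleftrightarrow> ?R")
proof
  assume ?L
  then obtain I where I: "has_KS_integral norm f g a b I" by (auto simp: KS_integrable_def)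
  show ?R
  proof (intro allI impI)
    fix \<epsilon> :: real assume "\<epsilon> > 0"
    then obtain \<delta> where d: "\<And>t. 0 < \<delta> t" "\<And>xs. fine_chain \<delta> a b xs \<Longrightarrow>
       norm (stieltjes_sum g f xs - I) < \<epsilon> / 2"
      using has_KS_integral_gauge[OF I, of "\<epsilon> / 2"] by auto
    have "norm (stieltjes_sum g f xs - stieltjes_sum g f ys) < \<epsilon>"
      if "fine_chain \<delta> a b xs"
         "fine_chain \<delta> a b ys" for xs ys
      using d(2)[OF that(1)] d(2)[OF that(2)] norm_triangle_half_l by blast
    with d(1) show "\<exists>\<delta>. (\<forall>t. 0 < \<delta> t) \<and>
     (\<forall>xs ys. fine_chain \<delta> a b xs \<and>
              fine_chain \<delta> a b ys \<longrightarrow>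
        norm (stieltjes_sum g f xs - stieltjes_sum g f ys) < \<epsilon>)" by blast
  qed
next
  assume R: ?R
  have "\<exists>\<delta>. (\<forall>t. 0 < \<delta> t) \<and> (\<forall>xs ys. fine_chain \<delta> a b xs \<and>
              fine_chain \<delta> a b ys \<longrightarrow>
        norm (stieltjes_sum g f xs - stieltjes_sum g f ys) < inverse (Suc n))" for n :: nat
    using R by auto
  then have "\<forall>n. \<exists>\<delta>. (\<forall>t. 0 < \<delta> t) \<and> (\<forall>xs ys. fine_chain \<delta> a b xs \<and>
              fine_chain \<delta> a b ys \<longrightarrow>
        norm (stieltjes_sum g f xs - stieltjes_sum g f ys) < inverse (Suc n))" ..
  from choice[OF this] obtain D where D: "\<And>n t. 0 < D n t"
    "\<And>n xs ys. fine_chain (D n) a b xs \<Longrightarrow>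
       fine_chain (D n) a b ys \<Longrightarrow>
        norm (stieltjes_sum g f xs - stieltjes_sum g f ys) < inverse (Suc n)"
    by blast
  \<comment> \<open>The minimum of the first \<open>n + 1\<close> gauges makes the chosen partitions comparable for all later
    indices, so that the sums form a Cauchy sequence.\<close>
  define E where "E n t = Min ((\<lambda>i. D i t) ` {..n})" for n t
  have Epos: "0 < E n t" for n t unfolding E_def by (subst Min_gr_iff) (use D in auto)
  have ED: "fine_at (D i) x" if "fine_at (E n) x" "i \<le> n" for i n x
  proof -
    have "E n t \<le> D i t" for t unfolding E_def using that by (intro Min_le) auto
    then show ?thesis using that unfolding fine_at_def
      by (auto split: prod.splits) (smt (verit))+
  qed
  have "\<forall>n. \<exists>xs. fine_chain (E n) a b xs"
    using fine_chain_exists[OF ab, OF Epos] by simp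
  from choice[OF this] obtain X where X: "\<And>n. fine_chain (E n) a b (X n)"
    by blast
  have close: "norm (stieltjes_sum g f xs - stieltjes_sum g f (X m)) < inverse (Suc n)"
    if "fine_chain (D n) a b xs" "n \<le> m" for xs n m
    using that X[of m] ED by (intro D(2)) (auto simp: fine_chain_def)
  have "Cauchy (\<lambda>n. stieltjes_sum g f (X n))"
  proof (rule metric_CauchyI)
    fix e :: real assume "e > 0"
    then obtain N where N: "inverse (Suc N) < e" using reals_Archimedean by blast
    have "dist (stieltjes_sum g f (X m)) (stieltjes_sum g f (X n)) < e" if "m \<ge> N" "n \<ge> N" for m n
    proof -
      have "fine_chain (D N) a b (X m)" using X[of m] ED that by (auto simp: fine_chain_def)
      from close[OF this \<open>n \<ge> N\<close>] N show ?thesis by (simp add: dist_norm)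
    qed
    then show "\<exists>M. \<forall>m\<ge>M. \<forall>n\<ge>M. dist (stieltjes_sum g f (X m)) (stieltjes_sum g f (X n)) < e"
      by blast
  qed
  then obtain I where I: "(\<lambda>n. stieltjes_sum g f (X n)) \<longlonglongrightarrow> I"
    using Cauchy_convergent_iff convergentD by blast
  have "has_KS_integral norm f g a b I"
    unfolding has_KS_integral_iff_chain
  proof (intro allI impI)
    fix \<epsilon> :: real assume "\<epsilon> > 0"
    then obtain n where n: "inverse (Suc n) < \<epsilon>" using reals_Archimedean by blast
    have "norm (stieltjes_sum g f xs - I) < \<epsilon>"
      if xs: "fine_chain (D n) a b xs" for xs
    proof -
      have "norm (stieltjes_sum g f xs - I) \<le> inverse (Suc n)"
      proof (rule Lim_norm_ubound)
        show "(\<lambda>m. stieltjes_sum g f xs - stieltjes_sum g f (X m)) \<longlonglongrightarrow> stieltjes_sum g f xs - I"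
          by (intro tendsto_intros I)
        show "\<forall>\<^sub>F m in sequentially. norm (stieltjes_sum g f xs - stieltjes_sum g f (X m)) \<le> inverse (Suc n)"
          using close[OF xs] by (intro eventually_sequentiallyI[of n]) (meson less_imp_le)
      qed simp
      with n show ?thesis by linarith
    qed
    then show "\<exists>\<delta>. (\<forall>t. 0 < \<delta> t) \<and>
        (\<forall>xs. fine_chain \<delta> a b xs \<longrightarrow>
           norm (stieltjes_sum g f xs - I) < \<epsilon>)"
      using D(1) by (intro exI[of _ "D n"]) auto
  qed
  then show ?L by (auto simp: KS_integrable_def)
qed

lemma KS_integrable_subinterval:
  fixes f :: "real \<Rightarrow> 'a::euclidean_space"
  assumes int: "KS_on g f a b" and "a \<le> c" "c \<le> d" "d \<le> b"
  shows "KS_on g f c d"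
proof -
  have ab: "a \<le> b" using assms by linarith
  show ?thesis
    unfolding KS_integrable_Cauchy[OF \<open>c \<le> d\<close>]
  proof (intro allI impI)
    fix \<epsilon> :: real assume "\<epsilon> > 0"
    then obtain \<delta> where d: "\<And>t. 0 < \<delta> t" and
      sm: "\<And>xs ys. fine_chain \<delta> a b xs \<Longrightarrow>
              fine_chain \<delta> a b ys \<Longrightarrow>
        norm (stieltjes_sum g f xs - stieltjes_sum g f ys) < \<epsilon>"
      using int[unfolded KS_integrable_Cauchy[OF ab]] by blast
    obtain ps qs where "fine_chain \<delta> a c ps"
        "fine_chain \<delta> d b qs"
      using fine_chain_exists[OF \<open>a \<le> c\<close>, of \<delta>] fine_chain_exists[OF \<open>d \<le> b\<close>, of \<delta>] d by blast
    then have "norm (stieltjes_sum g f xs - stieltjes_sum g f ys) < \<epsilon>"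
      if "fine_chain \<delta> c d xs"
         "fine_chain \<delta> c d ys" for xs ys
      using sm[of "ps @ xs @ qs" "ps @ ys @ qs"] that
      by (auto intro: fine_chain_append)
    with d show "\<exists>\<delta>. (\<forall>t. 0 < \<delta> t) \<and>
     (\<forall>xs ys. fine_chain \<delta> c d xs \<and>
              fine_chain \<delta> c d ys \<longrightarrow>
        norm (stieltjes_sum g f xs - stieltjes_sum g f ys) < \<epsilon>)" by blast
  qed
qed

lemma KS_integral_combine:
  fixes f :: "real \<Rightarrow> 'a::euclidean_space"
  assumes int: "KS_on g f a b" and ac: "a \<le> c" and cb: "c \<le> b"
  shows "KS_int g f a b = KS_int g f a c + KS_int g f c b"
proof -
  have ab: "a \<le> b" using ac cb by linarith
  have I: "has_KS_integral norm f g a b (KS_int g f a b)"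
      "has_KS_integral norm f g a c (KS_int g f a c)"
      "has_KS_integral norm f g c b (KS_int g f c b)"
    by (intro has_KS_integral_KS_integral ab ac cb int KS_integrable_subinterval[OF int] order_refl)+
  have "norm (KS_int g f a c + KS_int g f c b - KS_int g f a b) \<le> 0 + e" if e: "e > 0" for e
  proof -
    from e have e3: "e / 3 > 0" by simp
    obtain \<delta>1 where d1: "\<And>t. 0 < \<delta>1 t" "\<And>xs. fine_chain \<delta>1 a b xs \<Longrightarrow>
      norm (stieltjes_sum g f xs - KS_int g f a b) < e / 3"
      using has_KS_integral_gauge[OF I(1) e3] by blast
    obtain \<delta>2 where d2: "\<And>t. 0 < \<delta>2 t" "\<And>xs. fine_chain \<delta>2 a c xs \<Longrightarrow>
      norm (stieltjes_sum g f xs - KS_int g f a c) < e / 3"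
      using has_KS_integral_gauge[OF I(2) e3] by blast
    obtain \<delta>3 where d3: "\<And>t. 0 < \<delta>3 t" "\<And>xs. fine_chain \<delta>3 c b xs \<Longrightarrow>
      norm (stieltjes_sum g f xs - KS_int g f c b) < e / 3"
      using has_KS_integral_gauge[OF I(3) e3] by blast
    obtain xs where xs: "fine_chain (\<lambda>t. min (\<delta>1 t) (\<delta>2 t)) a c xs"
      using fine_chain_exists[OF ac, of "\<lambda>t. min (\<delta>1 t) (\<delta>2 t)"] d1 d2 by auto
    obtain ys where ys: "fine_chain (\<lambda>t. min (\<delta>1 t) (\<delta>3 t)) c b ys"
      using fine_chain_exists[OF cb, of "\<lambda>t. min (\<delta>1 t) (\<delta>3 t)"] d1 d3 by auto
    have "norm (stieltjes_sum g f (xs @ ys) - KS_int g f a b) < e / 3"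
      using xs ys by (intro d1(2) fine_chain_append[of _ _ c]) (auto dest: fine_chain_min)
    moreover have "norm (stieltjes_sum g f xs - KS_int g f a c) < e / 3"
      using xs by (intro d2(2)) (auto dest: fine_chain_min)
    moreover have "norm (stieltjes_sum g f ys - KS_int g f c b) < e / 3"
      using ys by (intro d3(2)) (auto dest: fine_chain_min)
    moreover have eq: "KS_int g f a c + KS_int g f c b - KS_int g f a b
       = (stieltjes_sum g f (xs @ ys) - KS_int g f a b) - ((stieltjes_sum g f xs - KS_int g f a c)
          + (stieltjes_sum g f ys - KS_int g f c b))" by simp
    moreover have "norm (KS_int g f a c + KS_int g f c b - KS_int g f a b)
       \<le> norm (stieltjes_sum g f (xs @ ys) - KS_int g f a b) + (norm (stieltjes_sum g f xs - KS_int g f a c)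
          + norm (stieltjes_sum g f ys - KS_int g f c b))"
      unfolding eq by (intro order_trans[OF norm_triangle_ineq4] add_left_mono norm_triangle_ineq)
    ultimately show ?thesis by linarith
  qed
  then have "norm (KS_int g f a c + KS_int g f c b - KS_int g f a b) \<le> 0"
    by (rule field_le_epsilon)
  then show ?thesis by simp
qed

lemma KS_integral_chain:
  fixes f :: "real \<Rightarrow> 'a::euclidean_space"
  assumes "tagged_chain a b xs" "KS_on g f a b"
  shows "KS_int g f a b = (\<Sum>(u, t, v)\<leftarrow>xs. KS_int g f u v)"
  using assms
proof (induction a b xs rule: tagged_chain.induct)
  case (2 a b u t v xs)
  then have le: "a \<le> v" "v \<le> b" by (auto dest: tagged_chain_le)
  have "KS_on g f v b" using KS_integrable_subinterval[OF 2(3) le order_refl] .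
  with 2 KS_integral_combine[OF 2(3) le] show ?case by auto
qed simp

lemma KS_integral_diff:
  fixes f1 f2 :: "real \<Rightarrow> 'a::euclidean_space"
  assumes ab: "a \<le> b" and i1: "KS_on g f1 a b" and i2: "KS_on g f2 a b"
  shows "KS_on g (\<lambda>s. f1 s - f2 s) a b"
    and "KS_int g (\<lambda>s. f1 s - f2 s) a b = KS_int g f1 a b - KS_int g f2 a b"
proof -
  have *: "has_KS_integral norm (\<lambda>s. f1 s - f2 s) g a b (KS_int g f1 a b - KS_int g f2 a b)"
    unfolding has_KS_integral_iff_chain
  proof (intro allI impI)
    fix e :: real assume "e > 0"
    then have e2: "e / 2 > 0" by simp
    obtain \<delta>1 where d1: "\<And>t. 0 < \<delta>1 t" "\<And>xs. fine_chain \<delta>1 a b xs \<Longrightarrow>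
      norm (stieltjes_sum g f1 xs - KS_int g f1 a b) < e / 2"
      using has_KS_integral_gauge[OF has_KS_integral_KS_integral[OF ab i1] e2] by blast
    obtain \<delta>2 where d2: "\<And>t. 0 < \<delta>2 t" "\<And>xs. fine_chain \<delta>2 a b xs \<Longrightarrow>
      norm (stieltjes_sum g f2 xs - KS_int g f2 a b) < e / 2"
      using has_KS_integral_gauge[OF has_KS_integral_KS_integral[OF ab i2] e2] by blast
    have eq: "stieltjes_sum g (\<lambda>s. f1 s - f2 s) xs = stieltjes_sum g f1 xs - stieltjes_sum g f2 xs" for xs
      by (induction xs) (auto simp: algebra_simps)
    have "norm (stieltjes_sum g (\<lambda>s. f1 s - f2 s) xs - (KS_int g f1 a b - KS_int g f2 a b)) < e"
      if xs: "fine_chain (\<lambda>t. min (\<delta>1 t) (\<delta>2 t)) a b xs" for xs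
    proof -
      have "norm (stieltjes_sum g f1 xs - KS_int g f1 a b) < e / 2"
        "norm (stieltjes_sum g f2 xs - KS_int g f2 a b) < e / 2"
        using d1(2)[OF fine_chain_min(1)[OF xs]] d2(2)[OF fine_chain_min(2)[OF xs]] by simp_all
      moreover have "stieltjes_sum g (\<lambda>s. f1 s - f2 s) xs - (KS_int g f1 a b - KS_int g f2 a b)
        = (stieltjes_sum g f1 xs - KS_int g f1 a b) - (stieltjes_sum g f2 xs - KS_int g f2 a b)"
        by (simp add: eq)
      ultimately show ?thesis
        by (smt (verit) field_sum_of_halves norm_triangle_ineq4)
    qed
    then show "\<exists>\<delta>. (\<forall>t. 0 < \<delta> t) \<and>
        (\<forall>xs. fine_chain \<delta> a b xs \<longrightarrow>
           norm (stieltjes_sum g (\<lambda>s. f1 s - f2 s) xs - (KS_int g f1 a b - KS_int g f2 a b)) < e)"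
      using d1(1) d2(1) by (intro exI[of _ "\<lambda>t. min (\<delta>1 t) (\<delta>2 t)"]) auto
  qed
  show "KS_on g (\<lambda>s. f1 s - f2 s) a b"
    using * by (auto simp: KS_integrable_def)
  show "KS_int g (\<lambda>s. f1 s - f2 s) a b = KS_int g f1 a b - KS_int g f2 a b"
    using KS_integral_eqI[OF ab *] .
qed

section \<open>The Saks--Henstock lemma for countable families\<close>

definition KS_error :: "(real \<Rightarrow> real) \<Rightarrow> (real \<Rightarrow> 'a::euclidean_space) \<Rightarrow> real \<times> real \<times> real \<Rightarrow> 'a" where
  "KS_error g f x = (case x of (u, t, v) \<Rightarrow> (g v - g u) *\<^sub>R f t - KS_int g f u v)"

lemma chain_telescope:
  fixes K :: "real \<Rightarrow> 'a::real_vector"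
  shows "tagged_chain a b xs \<Longrightarrow> (\<Sum>(u, t, v)\<leftarrow>xs. K v - K u) = K b - K a"
  by (induction a b xs rule: tagged_chain.induct) auto

lemma norm_sum_list_le:
  fixes f :: "'x \<Rightarrow> 'a::real_normed_vector"
  assumes "\<And>x. x \<in> set xs \<Longrightarrow> norm (f x) \<le> B x"
  shows "norm (\<Sum>x\<leftarrow>xs. f x) \<le> (\<Sum>x\<leftarrow>xs. B x)"
  using assms by (induction xs) (auto intro: norm_triangle_le add_mono)

lemma sum_list_sum_swap:
  fixes F :: "'x \<Rightarrow> 'b \<Rightarrow> real"
  shows "(\<Sum>x\<leftarrow>xs. \<Sum>b\<in>B. F x b) = (\<Sum>b\<in>B. \<Sum>x\<leftarrow>xs. F x b)"
  by (induction xs) (simp_all add: sum.distrib)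

text \<open>Refining only the pieces outside a chosen collection \<open>Q\<close> of fine pieces drives their errors
  to zero; what remains is the total error on \<open>Q\<close>.\<close>

lemma refine_outside:
  fixes f :: "real \<Rightarrow> 'a::euclidean_space" and \<eta> :: real
  assumes "tagged_chain a b xs" "KS_on g f a b" "\<And>t. 0 < \<delta> t" "\<eta> > 0"
    and "\<And>x. x \<in> set xs \<Longrightarrow> Q x \<Longrightarrow> fine_at \<delta> x"
  shows "\<exists>ys. fine_chain \<delta> a b ys \<and>
    norm (stieltjes_sum g f ys - (KS_int g f a b + (\<Sum>x\<leftarrow>filter Q xs. KS_error g f x))) \<le> \<eta> * length xs"
  using assms
proof (induction a b xs rule: tagged_chain.induct)
  case (1 a b)
  then show ?case by (intro exI[of _ "[]"]) (simp add: fine_chain_def)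
next
  case (2 a b u t v xs)
  then have ch: "u = a" "u \<le> t" "t \<le> v" "tagged_chain v b xs" by auto
  then have le: "a \<le> v" "v \<le> b" by (auto dest: tagged_chain_le)
  have i1: "KS_on g f a v" and i2: "KS_on g f v b"
    using KS_integrable_subinterval[OF 2(3)] le by auto
  have comb: "KS_int g f a b = KS_int g f a v + KS_int g f v b"
    using KS_integral_combine[OF 2(3) le] .
  let ?E = "\<Sum>x\<leftarrow>filter Q xs. KS_error g f x"
  obtain ys where ys: "fine_chain \<delta> v b ys"
    "norm (stieltjes_sum g f ys - (KS_int g f v b + ?E)) \<le> \<eta> * length xs"
    using 2(1)[OF ch(4) i2] 2(4-6) by auto
  show ?case
  proof (cases "Q (u, t, v)")
    case True
    then have "fine_at \<delta> (u, t, v)" using 2(6) by auto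
    then have "fine_chain \<delta> a b ((u, t, v) # ys)" using ys ch by (auto simp: fine_chain_def)
    moreover have eq: "stieltjes_sum g f ((u, t, v) # ys) -
       (KS_int g f a b + (\<Sum>x\<leftarrow>filter Q ((u, t, v) # xs). KS_error g f x))
       = stieltjes_sum g f ys - (KS_int g f v b + ?E)"
      using True by (simp add: comb KS_error_def ch(1))
    have "\<eta> * length xs \<le> \<eta> * length ((u, t, v) # xs)" using \<open>\<eta> > 0\<close> by simp
    then have "norm (stieltjes_sum g f ((u, t, v) # ys) -
       (KS_int g f a b + (\<Sum>x\<leftarrow>filter Q ((u, t, v) # xs). KS_error g f x))) \<le> \<eta> * length ((u, t, v) # xs)"
      unfolding eq using ys(2) by linarith
    ultimately show ?thesis by blast
  next
    case False
    obtain \<delta>' where d: "\<And>t. 0 < \<delta>' t" "\<And>xs. fine_chain \<delta>' a v xs \<Longrightarrow>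
      norm (stieltjes_sum g f xs - KS_int g f a v) < \<eta>"
      using has_KS_integral_gauge[OF has_KS_integral_KS_integral[OF le(1) i1] \<open>\<eta> > 0\<close>] by blast
    obtain zs where zs: "fine_chain (\<lambda>t. min (\<delta> t) (\<delta>' t)) a v zs"
      using fine_chain_exists[OF le(1), of "\<lambda>t. min (\<delta> t) (\<delta>' t)"] d 2(4) by auto
    have "fine_chain \<delta> a b (zs @ ys)"
      using fine_chain_append[OF fine_chain_min(1)[OF zs] ys(1)] .
    moreover have eq: "stieltjes_sum g f (zs @ ys) -
       (KS_int g f a b + (\<Sum>x\<leftarrow>filter Q ((u, t, v) # xs). KS_error g f x))
       = (stieltjes_sum g f zs - KS_int g f a v) + (stieltjes_sum g f ys - (KS_int g f v b + ?E))"
      using False by (simp add: comb)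
    have "norm (stieltjes_sum g f (zs @ ys) -
       (KS_int g f a b + (\<Sum>x\<leftarrow>filter Q ((u, t, v) # xs). KS_error g f x)))
       \<le> \<eta> + \<eta> * length xs"
      unfolding eq using d(2)[OF fine_chain_min(2)[OF zs]] ys(2)
      by (intro norm_triangle_le add_mono) auto
    then have "norm (stieltjes_sum g f (zs @ ys) -
       (KS_int g f a b + (\<Sum>x\<leftarrow>filter Q ((u, t, v) # xs). KS_error g f x)))
       \<le> \<eta> * length ((u, t, v) # xs)"
      by (simp add: algebra_simps)
    ultimately show ?thesis by blast
  qed
qed

text \<open>The gauge that makes the whole sum accurate makes every partial sum of errors small, by
  refining the other pieces. Splitting by coordinate and sign turns this into a
  bound on the sum of the norms of the errors. The bound concerns the \<open>\<delta>\<close>-fine pieces of an arbitrary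
  partition, so that it can be used when different pieces are fine for different gauges.\<close>

lemma Saks_Henstock:
  fixes f :: "real \<Rightarrow> 'a::euclidean_space"
  assumes ab: "a \<le> b" and int: "KS_on g f a b" and e: "\<epsilon> > 0"
  shows "\<exists>\<delta>. (\<forall>t. 0 < \<delta> t) \<and> (\<forall>xs. tagged_chain a b xs \<longrightarrow>
           (\<Sum>x\<leftarrow>filter (fine_at \<delta>) xs. norm (KS_error g f x)) \<le> \<epsilon>)"
proof -
  define \<epsilon>' where "\<epsilon>' = \<epsilon> / (2 * DIM('a))"
  have e': "\<epsilon>' > 0" using e by (simp add: \<epsilon>'_def)
  obtain \<delta> where d: "\<And>t. 0 < \<delta> t" "\<And>xs. fine_chain \<delta> a b xs \<Longrightarrow>
      norm (stieltjes_sum g f xs - KS_int g f a b) < \<epsilon>'"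
    using has_KS_integral_gauge[OF has_KS_integral_KS_integral[OF ab int] e'] by blast
  have part: "norm (\<Sum>x\<leftarrow>filter Q xs. KS_error g f x) \<le> \<epsilon>'"
    if ch: "tagged_chain a b xs" and Q: "\<And>x. x \<in> set xs \<Longrightarrow> Q x \<Longrightarrow> fine_at \<delta> x" for Q xs
  proof (rule field_le_epsilon)
    fix e :: real assume "e > 0"
    define \<eta> where "\<eta> = e / (length xs + 1)"
    have "\<eta> > 0" using \<open>e > 0\<close> by (simp add: \<eta>_def)
    have "\<eta> * length xs \<le> e" using \<open>e > 0\<close> by (simp add: \<eta>_def field_simps)
    obtain ys where ys: "fine_chain \<delta> a b ys"
      "norm (stieltjes_sum g f ys - (KS_int g f a b + (\<Sum>x\<leftarrow>filter Q xs. KS_error g f x))) \<le> \<eta> * length xs"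
      using refine_outside[where \<delta> = \<delta> and Q = Q, OF ch int d(1) \<open>\<eta> > 0\<close> Q] by blast
    have "norm (stieltjes_sum g f ys - KS_int g f a b) < \<epsilon>'" by (rule d(2)[OF ys(1)])
    moreover have "(\<Sum>x\<leftarrow>filter Q xs. KS_error g f x) = (stieltjes_sum g f ys - KS_int g f a b)
       - (stieltjes_sum g f ys - (KS_int g f a b + (\<Sum>x\<leftarrow>filter Q xs. KS_error g f x)))" by simp
    ultimately show "norm (\<Sum>x\<leftarrow>filter Q xs. KS_error g f x) \<le> \<epsilon>' + e"
      using ys(2) \<open>\<eta> * length xs \<le> e\<close> by (smt (verit) norm_triangle_ineq4)
  qed
  have sgn: "(\<Sum>x\<leftarrow>filter P xs. \<bar>E x \<bullet> b\<bar>) = (\<Sum>x\<leftarrow>filter (\<lambda>x. P x \<and> E x \<bullet> b \<ge> 0) xs. E x) \<bullet> b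
      - (\<Sum>x\<leftarrow>filter (\<lambda>x. P x \<and> \<not> E x \<bullet> b \<ge> 0) xs. E x) \<bullet> b"
    for P and E :: "real \<times> real \<times> real \<Rightarrow> 'a" and b xs
    by (induction xs) (auto simp: inner_add_left)
  have "(\<Sum>x\<leftarrow>filter (fine_at \<delta>) xs. norm (KS_error g f x)) \<le> \<epsilon>" if ch: "tagged_chain a b xs" for xs
  proof -
    let ?E = "KS_error g f"
    have "(\<Sum>x\<leftarrow>filter (fine_at \<delta>) xs. norm (?E x))
      \<le> (\<Sum>x\<leftarrow>filter (fine_at \<delta>) xs. \<Sum>b\<in>Basis. \<bar>?E x \<bullet> b\<bar>)"
      by (intro sum_list_mono norm_le_l1)
    also have "\<dots> = (\<Sum>b\<in>Basis. \<Sum>x\<leftarrow>filter (fine_at \<delta>) xs. \<bar>?E x \<bullet> b\<bar>)"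
      by (rule sum_list_sum_swap)
    also have "\<dots> \<le> (\<Sum>b\<in>(Basis::'a set). 2 * \<epsilon>')"
    proof (rule sum_mono)
      fix b :: 'a assume b: "b \<in> Basis"
      have "(\<Sum>x\<leftarrow>filter (\<lambda>x. fine_at \<delta> x \<and> ?E x \<bullet> b \<ge> 0) xs. ?E x) \<bullet> b \<le> \<epsilon>'"
        using part[OF ch, of "\<lambda>x. fine_at \<delta> x \<and> ?E x \<bullet> b \<ge> 0"] Basis_le_norm[OF b] by (smt (verit))
      moreover have "\<bar>(\<Sum>x\<leftarrow>filter (\<lambda>x. fine_at \<delta> x \<and> \<not> ?E x \<bullet> b \<ge> 0) xs. ?E x) \<bullet> b\<bar> \<le> \<epsilon>'"
        using part[OF ch, of "\<lambda>x. fine_at \<delta> x \<and> \<not> ?E x \<bullet> b \<ge> 0"] Basis_le_norm[OF b] by (smt (verit))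
      ultimately show "(\<Sum>x\<leftarrow>filter (fine_at \<delta>) xs. \<bar>?E x \<bullet> b\<bar>) \<le> 2 * \<epsilon>'"
        unfolding sgn by linarith
    qed
    also have "\<dots> = \<epsilon>" by (simp add: \<epsilon>'_def)
    finally show ?thesis .
  qed
  with d(1) show ?thesis by blast
qed

text \<open>A choice of one out of countably many error functions at each piece costs no more than a
  geometric series, since the pieces sharing the choice \<open>n\<close> contribute at most \<open>\<epsilon> / 2\<^sup>n\<^sup>+\<^sup>1\<close>.\<close>

lemma sum_list_select_le:
  fixes e :: "nat \<Rightarrow> 'x \<Rightarrow> real"
  assumes nonneg: "\<And>n x. x \<in> set xs \<Longrightarrow> 0 \<le> e n x"
    and le: "\<And>n. (\<Sum>x\<leftarrow>xs. e n x) \<le> \<epsilon> / 2 ^ Suc n"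
  shows "(\<Sum>x\<leftarrow>xs. e (m x) x) \<le> \<epsilon>"
proof -
  define N where "N = Suc (Max (insert 0 (m ` set xs)))"
  have mN: "m x < N" if "x \<in> set xs" for x
    unfolding N_def using that by (auto simp: less_Suc_eq_le intro!: Max_ge)
  have "0 \<le> (\<Sum>x\<leftarrow>xs. e 0 x)" using nonneg by (intro sum_list_nonneg) auto
  with le[of 0] have e0: "\<epsilon> \<ge> 0" by simp
  have "(\<Sum>x\<leftarrow>xs. e (m x) x) \<le> (\<Sum>x\<leftarrow>xs. \<Sum>n<N. e n x)"
  proof (rule sum_list_mono)
    fix x assume x: "x \<in> set xs"
    show "e (m x) x \<le> (\<Sum>n<N. e n x)"
      using mN[OF x] nonneg[OF x] by (intro member_le_sum) auto
  qed
  also have "\<dots> = (\<Sum>n<N. \<Sum>x\<leftarrow>xs. e n x)" by (rule sum_list_sum_swap)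
  also have "\<dots> \<le> (\<Sum>n<N. \<epsilon> / 2 ^ Suc n)" by (intro sum_mono le)
  also have "\<dots> = \<epsilon> * (1 - 1 / 2 ^ N)"
    by (induction N) (auto simp: field_simps)
  also have "\<dots> \<le> \<epsilon>" using e0 by (simp add: mult_left_le)
  finally show ?thesis .
qed

lemma Saks_Henstock_countable:
  fixes H :: "'i::countable \<Rightarrow> real \<Rightarrow> 'a::euclidean_space"
  assumes ab: "a \<le> b" and int: "\<And>i. KS_on g (H i) a b" and e: "\<epsilon> > 0"
  obtains D where "\<And>i t. 0 < D i t"
    "\<And>xs \<iota>. tagged_chain a b xs \<Longrightarrow> (\<And>x. x \<in> set xs \<Longrightarrow> fine_at (D (\<iota> x)) x) \<Longrightarrow>
        (\<Sum>x\<leftarrow>xs. norm (KS_error g (H (\<iota> x)) x)) \<le> \<epsilon>"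
proof -
  have "\<forall>i. \<exists>\<delta>. (\<forall>t. 0 < \<delta> t) \<and> (\<forall>xs. tagged_chain a b xs \<longrightarrow>
     (\<Sum>x\<leftarrow>filter (fine_at \<delta>) xs. norm (KS_error g (H i) x)) \<le> \<epsilon> / 2 ^ Suc (to_nat i))"
    by (intro allI Saks_Henstock ab int) (use e in auto)
  from choice[OF this] obtain D where D: "\<And>i t. 0 < D i t"
    "\<And>i xs. tagged_chain a b xs \<Longrightarrow>
     (\<Sum>x\<leftarrow>filter (fine_at (D i)) xs. norm (KS_error g (H i) x)) \<le> \<epsilon> / 2 ^ Suc (to_nat i)"
    by blast
  show thesis
  proof (rule that[of D])
    fix xs and \<iota> :: "real \<times> real \<times> real \<Rightarrow> 'i"
    assume ch: "tagged_chain a b xs" and fi: "\<And>x. x \<in> set xs \<Longrightarrow> fine_at (D (\<iota> x)) x"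
    \<comment> \<open>Indices outside the range of \<open>to_nat\<close> contribute nothing.\<close>
    define er where "er n x = (if n \<in> range (to_nat :: 'i \<Rightarrow> nat) \<and> fine_at (D (from_nat n)) x
       then norm (KS_error g (H (from_nat n)) x) else 0)" for n x
    have "(\<Sum>x\<leftarrow>xs. norm (KS_error g (H (\<iota> x)) x)) = (\<Sum>x\<leftarrow>xs. er (to_nat (\<iota> x)) x)"
      using fi by (intro arg_cong[of _ _ sum_list] map_cong) (auto simp: er_def)
    also have "\<dots> \<le> \<epsilon>"
    proof (rule sum_list_select_le)
      fix n
      show "(\<Sum>x\<leftarrow>xs. er n x) \<le> \<epsilon> / 2 ^ Suc n"
      proof (cases "n \<in> range (to_nat :: 'i \<Rightarrow> nat)")
        case True
        then obtain i :: 'i where n: "n = to_nat i" by blast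
        show ?thesis using D(2)[OF ch, of i] by (simp add: n er_def sum_list_map_filter' cong: if_cong)
      next
        case False
        then have "(\<Sum>x\<leftarrow>xs. er n x) = 0" by (induction xs) (auto simp: er_def)
        then show ?thesis using e by simp
      qed
    qed (simp add: er_def)
    finally show "(\<Sum>x\<leftarrow>xs. norm (KS_error g (H (\<iota> x)) x)) \<le> \<epsilon>" .
  qed (rule D(1))
qed

section \<open>Bounds for integrals along a curve\<close>

text \<open>The bound is known only for frozen values \<open>u\<close>. At each tag \<open>t\<close> the value \<open>z t\<close> is
  replaced by a nearby member of a countable dense set, chosen depending on \<open>t\<close>; the Saks--Henstock
  lemma for countable families handles this infinity of choices with a single gauge.\<close>

lemma KS_integral_superposition_bound:
  fixes F :: "real \<Rightarrow> 'b::second_countable_topology \<Rightarrow> 'a::euclidean_space" and K :: "real \<Rightarrow> real"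
  assumes ab: "a \<le> b" and g: "mono_on {a..b} g"
    and cont: "\<And>t. t \<in> {a..b} \<Longrightarrow> continuous_on UNIV (F t)"
    and int: "\<And>u. KS_on g (\<lambda>s. F s u) a b"
    and bound: "\<And>u c d. a \<le> c \<Longrightarrow> c \<le> d \<Longrightarrow> d \<le> b \<Longrightarrow> norm (KS_int g (\<lambda>s. F s u) c d) \<le> K d - K c"
    and intz: "KS_on g (\<lambda>s. F s (z s)) a b"
  shows "norm (KS_int g (\<lambda>s. F s (z s)) a b) \<le> K b - K a"
proof -
  let ?I = "KS_int g (\<lambda>s. F s (z s)) a b"
  have gab: "g a \<le> g b" using mono_onD[OF g] ab by auto
  obtain B :: "'b set" where B: "countable B" "\<And>X. open X \<Longrightarrow> X \<noteq> {} \<Longrightarrow> \<exists>d\<in>B. d \<in> X"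
    using countable_dense_exists by blast
  have Bne: "B \<noteq> {}" using B(2)[of UNIV] by auto
  define q where "q = from_nat_into B"
  have main: "norm ?I \<le> K b - K a + \<epsilon> * (g b - g a + 2)" if e: "\<epsilon> > 0" for \<epsilon>
  proof -
    have "\<exists>j. t \<in> {a..b} \<longrightarrow> norm (F t (z t) - F t (q j)) \<le> \<epsilon>" for t
    proof (cases "t \<in> {a..b}")
      case True
      have "open (F t -` ball (F t (z t)) \<epsilon>)"
        by (rule open_vimage[OF open_ball cont[OF True]])
      moreover have "z t \<in> F t -` ball (F t (z t)) \<epsilon>" using e by simp
      ultimately obtain d where "d \<in> B" "F t d \<in> ball (F t (z t)) \<epsilon>"
        using B(2) by blast
      moreover obtain j where "q j = d"
        using from_nat_into_surj[OF B(1) \<open>d \<in> B\<close>] unfolding q_def by blast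
      ultimately show ?thesis by (auto simp: dist_norm intro!: exI[of _ j])
    qed auto
    then obtain j where j: "\<And>t. t \<in> {a..b} \<Longrightarrow> norm (F t (z t) - F t (q (j t))) \<le> \<epsilon>" by metis
    obtain D where D: "\<And>i t. 0 < D i t"
      "\<And>xs \<iota>. tagged_chain a b xs \<Longrightarrow> (\<And>x. x \<in> set xs \<Longrightarrow> fine_at (D (\<iota> x)) x) \<Longrightarrow>
        (\<Sum>x\<leftarrow>xs. norm (KS_error g (\<lambda>s. F s (q (\<iota> x))) x)) \<le> \<epsilon>"
      using Saks_Henstock_countable[where H = "\<lambda>i s. F s (q i)", OF ab int e] by blast
    obtain \<delta> where d: "\<And>t. 0 < \<delta> t" "\<And>xs. fine_chain \<delta> a b xs \<Longrightarrow>
      norm (stieltjes_sum g (\<lambda>s. F s (z s)) xs - ?I) < \<epsilon>"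
      using has_KS_integral_gauge[OF has_KS_integral_KS_integral[OF ab intz] e] by blast
    obtain xs where xs: "fine_chain (\<lambda>t. min (\<delta> t) (D (j t) t)) a b xs"
      using fine_chain_exists[OF ab, of "\<lambda>t. min (\<delta> t) (D (j t) t)"] d(1) D(1) by auto
    define \<iota> where "\<iota> x = j (fst (snd x))" for x :: "real \<times> real \<times> real"
    have ch: "tagged_chain a b xs" using xs by (simp add: fine_chain_def)
    have "fine_at (D (\<iota> x)) x" if "x \<in> set xs" for x
      using fine_chain_min(2)[OF xs] that by (auto simp: fine_chain_def fine_at_def \<iota>_def split: prod.splits)
    from D(2)[OF ch this] have err: "(\<Sum>x\<leftarrow>xs. norm (KS_error g (\<lambda>s. F s (q (\<iota> x))) x)) \<le> \<epsilon>" .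
    have "norm (stieltjes_sum g (\<lambda>s. F s (z s)) xs)
      \<le> (\<Sum>x\<leftarrow>xs. norm (KS_error g (\<lambda>s. F s (q (\<iota> x))) x) +
           ((\<epsilon> *\<^sub>R (case x of (u, t, v) \<Rightarrow> g v - g u)) + (case x of (u, t, v) \<Rightarrow> K v - K u)))"
      unfolding stieltjes_sum_def
    proof (rule norm_sum_list_le)
      fix x assume x: "x \<in> set xs"
      obtain u t v where xx: "x = (u, t, v)" by (cases x)
      have m: "a \<le> u" "u \<le> t" "t \<le> v" "v \<le> b" using tagged_chain_mem[OF ch x[unfolded xx]] .
      have gv: "g u \<le> g v" using mono_onD[OF g] m by auto
      have "(g v - g u) *\<^sub>R F t (z t) = KS_error g (\<lambda>s. F s (q (\<iota> x))) x +
         ((g v - g u) *\<^sub>R (F t (z t) - F t (q (j t))) + KS_int g (\<lambda>s. F s (q (j t))) u v)"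
        by (simp add: KS_error_def xx \<iota>_def algebra_simps)
      moreover have "norm ((g v - g u) *\<^sub>R (F t (z t) - F t (q (j t)))) \<le> \<epsilon> * (g v - g u)"
        using mult_left_mono[OF j[of t], of "g v - g u"] m gv by (simp add: mult.commute)
      moreover have "norm (KS_int g (\<lambda>s. F s (q (j t))) u v) \<le> K v - K u"
        using m by (intro bound) auto
      ultimately show "norm (case x of (u, t, v) \<Rightarrow> (g v - g u) *\<^sub>R F t (z t))
        \<le> norm (KS_error g (\<lambda>s. F s (q (\<iota> x))) x) +
           ((\<epsilon> *\<^sub>R (case x of (u, t, v) \<Rightarrow> g v - g u)) + (case x of (u, t, v) \<Rightarrow> K v - K u))"
        by (auto simp: xx intro!: norm_triangle_le add_mono)
    qed
    also have "\<dots> = (\<Sum>x\<leftarrow>xs. norm (KS_error g (\<lambda>s. F s (q (\<iota> x))) x)) + (\<epsilon> * (g b - g a) + (K b - K a))"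
      using chain_telescope[OF ch, of g] chain_telescope[OF ch, of K]
      by (simp add: sum_list_addf sum_list_const_mult)
    finally have "norm (stieltjes_sum g (\<lambda>s. F s (z s)) xs) \<le> \<epsilon> + (\<epsilon> * (g b - g a) + (K b - K a))"
      using err by linarith
    moreover have "norm (stieltjes_sum g (\<lambda>s. F s (z s)) xs - ?I) < \<epsilon>"
      by (rule d(2)[OF fine_chain_min(1)[OF xs]])
    ultimately show ?thesis
      using norm_triangle_sub[of ?I "stieltjes_sum g (\<lambda>s. F s (z s)) xs"]
      by (simp add: norm_minus_commute algebra_simps)
  qed
  show ?thesis
  proof (rule field_le_epsilon)
    fix e :: real assume "e > 0"
    then show "norm ?I \<le> K b - K a + e"
      using main[of "e / (g b - g a + 2)"] gab by simp
  qed
qed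

section \<open>Subadditive interval functions\<close>

text \<open>Splitting at the tags makes every tag an end point of its interval, so that a gauge can keep
  any prescribed finite set out of the interior of the intervals.\<close>

lemma fine_chain_exists_endpoint_tags:
  assumes "a \<le> b" "\<And>t. 0 < \<delta> t"
  obtains xs where "fine_chain \<delta> a b xs" "\<And>u t v. (u, t, v) \<in> set xs \<Longrightarrow> t = u \<or> t = v"
proof -
  have split: "\<exists>ys. fine_chain \<delta> a b ys \<and> (\<forall>(u, t, v)\<in>set ys. t = u \<or> t = v)"
    if "tagged_chain a b xs" "\<forall>x\<in>set xs. fine_at \<delta> x" for a b xs
    using that
  proof (induction a b xs rule: tagged_chain.induct)
    case (1 a b)
    then show ?case by (intro exI[of _ "[]"]) (simp add: fine_chain_def)
  next
    case (2 a b u t v xs)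
    then obtain ys where "fine_chain \<delta> v b ys" "\<forall>(u, t, v)\<in>set ys. t = u \<or> t = v" by auto
    with 2 show ?case
      by (intro exI[of _ "(u, t, t) # (t, t, v) # ys"]) (auto simp: fine_chain_def fine_at_def)
  qed
  obtain xs where "tagged_chain a b xs" "\<forall>x\<in>set xs. fine_at \<delta> x"
    using fine_chain_exists[OF assms(1), of \<delta>] assms(2) by (auto simp: fine_chain_def)
  from split[OF this] obtain ys where "fine_chain \<delta> a b ys" "\<forall>(u, t, v)\<in>set ys. t = u \<or> t = v"
    by blast
  then show thesis by (intro that[of ys]) auto
qed

text \<open>By subadditivity, cutting the interval that contains \<open>c\<close> does not decrease the sum.\<close>

lemma chain_split:
  fixes q :: "real \<Rightarrow> real \<Rightarrow> real"
  assumes "tagged_chain u w xs" "u \<le> c" "c \<le> w" "a \<le> u" "w \<le> b"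
    and "\<And>x y z. a \<le> x \<Longrightarrow> x \<le> y \<Longrightarrow> y \<le> z \<Longrightarrow> z \<le> b \<Longrightarrow> q x z \<le> q x y + q y z"
  shows "\<exists>ys zs. tagged_chain u c ys \<and> tagged_chain c w zs \<and>
    (\<Sum>(u, t, v)\<leftarrow>xs. q u v) \<le> (\<Sum>(u, t, v)\<leftarrow>ys. q u v) + (\<Sum>(u, t, v)\<leftarrow>zs. q u v)"
  using assms
proof (induction u w xs rule: tagged_chain.induct)
  case (1 u w)
  then show ?case by (intro exI[of _ "[]"]) simp
next
  case (2 u w u' t v xs)
  then have ch: "u' = u" "u \<le> t" "t \<le> v" "tagged_chain v w xs" by auto
  then have vw: "v \<le> w" by (auto dest: tagged_chain_le)
  show ?case
  proof (cases "c \<le> v")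
    case True
    have "q u v \<le> q u c + q c v" using 2 True vw by (intro 2(7)) auto
    then show ?thesis using True ch 2
      by (intro exI[of _ "[(u, u, c)]"] exI[of _ "(c, c, v) # xs"]) simp
  next
    case False
    then obtain ys zs where "tagged_chain v c ys" "tagged_chain c w zs"
      "(\<Sum>(u, t, v)\<leftarrow>xs. q u v) \<le> (\<Sum>(u, t, v)\<leftarrow>ys. q u v) + (\<Sum>(u, t, v)\<leftarrow>zs. q u v)"
      using 2(1)[OF ch(4)] 2 ch by auto
    then show ?thesis using ch
      by (intro exI[of _ "(u, t, v) # ys"] exI[of _ zs]) simp
  qed
qed

text \<open>The interval containing \<open>s\<close> is cut off at \<open>s\<close>, and the intervals beyond it are dropped.\<close>

fun clipped_sum :: "(real \<Rightarrow> real \<Rightarrow> real) \<Rightarrow> (real \<times> real \<times> real) list \<Rightarrow> real \<Rightarrow> real" where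
  "clipped_sum q [] s = 0"
| "clipped_sum q ((u, t, v) # xs) s = (if s \<le> v then q u s else q u v + clipped_sum q xs s)"

lemma clipped_sum_start:
  assumes "tagged_chain c e D" "\<And>x. q x x = 0"
  shows "clipped_sum q D c = 0"
  using assms by (cases D) auto

lemma clipped_sum_end:
  assumes "tagged_chain c e D" "\<And>x. q x x = 0"
  shows "clipped_sum q D e = (\<Sum>(u, t, v)\<leftarrow>D. q u v)"
  using assms
proof (induction c e D rule: tagged_chain.induct)
  case (2 c e u t v D)
  then have "tagged_chain v e D" and IH: "clipped_sum q D e = (\<Sum>(u, t, v)\<leftarrow>D. q u v)" by auto
  then have "v \<le> e" by (auto dest: tagged_chain_le)
  show ?case
  proof (cases "e = v")
    case True
    then have "clipped_sum q D e = 0"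
      using clipped_sum_start[OF \<open>tagged_chain v e D\<close>] 2(3) by simp
    with True IH show ?thesis by simp
  qed (use IH \<open>v \<le> e\<close> in auto)
qed simp

text \<open>Inside one interval of the partition, subadditivity compares the increment with \<open>q u v\<close>; in
  general the pieces add up to at most \<open>V u v\<close>. The point is that the clipped sum is an
  additive quantity which records how much of the variation is already seen by single intervals.\<close>

lemma clipped_sum_increment:
  fixes q V :: "real \<Rightarrow> real \<Rightarrow> real"
  assumes "tagged_chain c e D" "c \<le> u" "u \<le> v" "v \<le> e" "a \<le> c" "e \<le> b"
    and q0: "\<And>x. q x x = 0"
    and sub: "\<And>x y z. a \<le> x \<Longrightarrow> x \<le> y \<Longrightarrow> y \<le> z \<Longrightarrow> z \<le> b \<Longrightarrow> q x z \<le> q x y + q y z"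
    and add: "\<And>x y z. a \<le> x \<Longrightarrow> x \<le> y \<Longrightarrow> y \<le> z \<Longrightarrow> z \<le> b \<Longrightarrow> V x z = V x y + V y z"
    and le: "\<And>x y. a \<le> x \<Longrightarrow> x \<le> y \<Longrightarrow> y \<le> b \<Longrightarrow> q x y \<le> V x y"
  shows "clipped_sum q D v - clipped_sum q D u \<le> V u v"
    and "\<lbrakk>\<And>s. s \<in> (snd \<circ> snd) ` set D \<Longrightarrow> \<not> (u < s \<and> s < v)\<rbrakk> \<Longrightarrow>
           clipped_sum q D v - clipped_sum q D u \<le> q u v"
proof -
  have "clipped_sum q D v - clipped_sum q D u \<le> V u v \<and>
     ((\<forall>s\<in>(snd \<circ> snd) ` set D. \<not> (u < s \<and> s < v)) \<longrightarrow>
           clipped_sum q D v - clipped_sum q D u \<le> q u v)"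
    using assms(1-6)
  proof (induction c e D arbitrary: u rule: tagged_chain.induct)
    case (1 c e)
    then have "u = v" "a \<le> v" "v \<le> b" by auto
    then show ?case using le[of v v] q0 by simp
  next
    case (2 c e c' t d D)
    then have ch: "c' = c" "c \<le> t" "t \<le> d" "tagged_chain d e D" by auto
    then have de: "d \<le> e" by (auto dest: tagged_chain_le)
    have Dd: "clipped_sum q D d = 0" by (rule clipped_sum_start[OF ch(4) q0])
    note IH = 2(1)[OF ch(4)]
    consider "v \<le> d" | "u \<le> d" "d < v" | "d < u" using \<open>u \<le> v\<close> by linarith
    then show ?case
    proof cases
      case 1
      have "q c v \<le> q c u + q u v" using 2 by (intro sub) auto
      moreover have "q u v \<le> V u v" using 2 by (intro le) auto
      ultimately show ?thesis using 1 \<open>u \<le> v\<close> ch(1) by auto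
    next
      case 2
      have W: "clipped_sum q ((c', t, d) # D) v - clipped_sum q ((c', t, d) # D) u
         = q c d - q c u + clipped_sum q D v" using 2 ch(1) by simp
      have s1: "q c d \<le> q c u + q u d" using 2 \<open>c \<le> u\<close> \<open>a \<le> c\<close> de \<open>e \<le> b\<close> by (intro sub) auto
      have IHd: "clipped_sum q D v - clipped_sum q D d \<le> V d v \<and>
         ((\<forall>s\<in>(snd \<circ> snd) ` set D. \<not> (d < s \<and> s < v)) \<longrightarrow>
           clipped_sum q D v - clipped_sum q D d \<le> q d v)"
        using 2 \<open>c \<le> u\<close> \<open>a \<le> c\<close> de \<open>e \<le> b\<close> \<open>v \<le> e\<close> by (intro IH) auto
      have "V u v = V u d + V d v" using 2 \<open>c \<le> u\<close> \<open>a \<le> c\<close> de \<open>e \<le> b\<close> \<open>v \<le> e\<close> by (intro add) auto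
      moreover have "q u d \<le> V u d" using 2 \<open>c \<le> u\<close> \<open>a \<le> c\<close> de \<open>e \<le> b\<close> \<open>v \<le> e\<close> by (intro le) auto
      moreover have "clipped_sum q ((c', t, d) # D) v - clipped_sum q ((c', t, d) # D) u \<le> q u v"
        if "\<forall>s\<in>(snd \<circ> snd) ` set ((c', t, d) # D). \<not> (u < s \<and> s < v)"
      proof -
        have "u = d" using that 2 by auto
        then show ?thesis using IHd that Dd q0 unfolding W by auto
      qed
      ultimately show ?thesis using W s1 IHd Dd by auto
    next
      case 3
      then have "clipped_sum q ((c', t, d) # D) v - clipped_sum q ((c', t, d) # D) u
        = clipped_sum q D v - clipped_sum q D u" using \<open>u \<le> v\<close> by auto
      moreover have "clipped_sum q D v - clipped_sum q D u \<le> V u v \<and>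
         ((\<forall>s\<in>(snd \<circ> snd) ` set D. \<not> (u < s \<and> s < v)) \<longrightarrow>
           clipped_sum q D v - clipped_sum q D u \<le> q u v)"
        using 2 3 ch by (intro IH) auto
      ultimately show ?thesis by simp
    qed
  qed
  then show "clipped_sum q D v - clipped_sum q D u \<le> V u v"
    and "\<lbrakk>\<And>s. s \<in> (snd \<circ> snd) ` set D \<Longrightarrow> \<not> (u < s \<and> s < v)\<rbrakk> \<Longrightarrow>
           clipped_sum q D v - clipped_sum q D u \<le> q u v" by auto
qed

section \<open>Vanishing variation of a dominated family\<close>

text \<open>The sets \<open>S p\<close> are the tails of the index set. For a sequence \<open>F\<close> of functions, \<open>H\<close> consists of
  the differences \<open>F m - F n\<close> and \<open>S p\<close> of the pairs with \<open>m, n \<ge> p\<close>.\<close>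

locale dominated_family =
  fixes g :: "real \<Rightarrow> real" and a b :: real and H :: "'i::countable \<Rightarrow> real \<Rightarrow> 'a::euclidean_space"
    and S :: "nat \<Rightarrow> 'i set" and K :: "real \<Rightarrow> real"
  assumes ab: "a \<le> b" and g: "mono_on {a..b} g" and int: "\<And>i. KS_on g (H i) a b"
    and S_ne: "\<And>p. S p \<noteq> {}" and S_antimono: "\<And>p p'. p \<le> p' \<Longrightarrow> S p' \<subseteq> S p"
    and dom: "\<And>i u v. i \<in> S 0 \<Longrightarrow> a \<le> u \<Longrightarrow> u \<le> v \<Longrightarrow> v \<le> b \<Longrightarrow> norm (KS_int g (H i) u v) \<le> K v - K u"
begin

text \<open>Inserting \<open>0\<close> makes the maximum meaningful for the empty set of indices.\<close>

definition peak :: "'i set \<Rightarrow> real \<Rightarrow> real \<Rightarrow> real" where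
  "peak F u v = Max (insert 0 ((\<lambda>i. norm (KS_int g (H i) u v)) ` F))"

lemma peak_ge: "finite F \<Longrightarrow> i \<in> F \<Longrightarrow> norm (KS_int g (H i) u v) \<le> peak F u v"
  unfolding peak_def by (intro Max_ge) auto

lemma peak_nonneg: "finite F \<Longrightarrow> 0 \<le> peak F u v"
  unfolding peak_def by (intro Max_ge) auto

lemma peak_leI:
  assumes "finite F" "0 \<le> B" "\<And>i. i \<in> F \<Longrightarrow> norm (KS_int g (H i) u v) \<le> B"
  shows "peak F u v \<le> B"
  unfolding peak_def using assms by (intro Max.boundedI) auto

lemma peak_empty [simp]: "peak {} u v = 0"
  by (simp add: peak_def)

lemma peak_refl: "peak F u u = 0"
proof -
  have "insert 0 ((\<lambda>i. norm (KS_int g (H i) u u)) ` F) = {0}" by auto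
  then show ?thesis unfolding peak_def by (metis Max_singleton)
qed

lemma peak_attained:
  assumes "finite F" "F \<noteq> {}"
  shows "\<exists>i\<in>F. peak F u v = norm (KS_int g (H i) u v)"
proof -
  have "peak F u v \<in> insert 0 ((\<lambda>i. norm (KS_int g (H i) u v)) ` F)"
    unfolding peak_def by (intro Max_in) (use assms in auto)
  moreover obtain i where "i \<in> F" using assms by auto
  ultimately show ?thesis using peak_ge[OF assms(1) \<open>i \<in> F\<close>, of u v] by auto
qed

lemma peak_triangle:
  assumes "finite F" "a \<le> u" "u \<le> v" "v \<le> w" "w \<le> b"
  shows "peak F u w \<le> peak F u v + peak F v w"
proof (rule peak_leI)
  fix i assume i: "i \<in> F"
  have "KS_int g (H i) u w = KS_int g (H i) u v + KS_int g (H i) v w"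
    using KS_integrable_subinterval[OF int] assms by (intro KS_integral_combine) auto
  then show "norm (KS_int g (H i) u w) \<le> peak F u v + peak F v w"
    using peak_ge[OF assms(1) i] by (auto intro!: norm_triangle_le add_mono)
qed (use assms peak_nonneg in auto)

lemma peak_mono: "finite F' \<Longrightarrow> F \<subseteq> F' \<Longrightarrow> peak F u v \<le> peak F' u v"
  by (rule peak_leI) (auto intro: finite_subset peak_nonneg peak_ge)

lemma peak_le_dom:
  assumes "finite F" "F \<subseteq> S 0" "a \<le> u" "u \<le> v" "v \<le> b"
  shows "peak F u v \<le> K v - K u"
proof (rule peak_leI)
  obtain i where "i \<in> S 0" using S_ne by auto
  show "0 \<le> K v - K u" using dom[OF \<open>i \<in> S 0\<close> assms(3-5)] norm_ge_zero by (rule order_trans[rotated])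
qed (use assms dom in auto)

text \<open>The joint variation of the functions \<open>H i\<close> with \<open>i \<in> S p\<close>: on every interval of a partition the
  largest of finitely many integrals counts. Only finite sets \<open>F\<close> of indices enter, because a
  gauge can be adapted to finitely many functions at a time.\<close>

definition variation :: "nat \<Rightarrow> real \<Rightarrow> real \<Rightarrow> real" where
  "variation p u v = (SUP (F, xs)\<in>{(F, xs). finite F \<and> F \<subseteq> S p \<and> tagged_chain u v xs}.
     \<Sum>(u, t, v)\<leftarrow>xs. peak F u v)"

lemma chain_peak_mono:
  assumes "finite F'" "F \<subseteq> F'"
  shows "(\<Sum>(u, t, v)\<leftarrow>xs. peak F u v) \<le> (\<Sum>(u, t, v)\<leftarrow>xs. peak F' u v)"
  using peak_mono[OF assms] by (intro sum_list_mono) auto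

lemma variation_bdd:
  assumes "a \<le> u" "v \<le> b"
  shows "bdd_above ((\<lambda>(F, xs). \<Sum>(u, t, v)\<leftarrow>xs. peak F u v) `
    {(F, xs). finite F \<and> F \<subseteq> S p \<and> tagged_chain u v xs})"
proof (rule bdd_aboveI2[where M = "K v - K u"])
  fix y assume "y \<in> {(F, xs). finite F \<and> F \<subseteq> S p \<and> tagged_chain u v xs}"
  then obtain F xs where y: "y = (F, xs)" "finite F" "F \<subseteq> S p" and ch: "tagged_chain u v xs" by auto
  have "F \<subseteq> S 0" using y(3) S_antimono[of 0 p] by auto
  have "(\<Sum>(u, t, v)\<leftarrow>xs. peak F u v) \<le> (\<Sum>(u, t, v)\<leftarrow>xs. K v - K u)"
  proof (rule sum_list_mono, clarify)
    fix x t z assume "(x, t, z) \<in> set xs"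
    from tagged_chain_mem[OF ch this] show "peak F x z \<le> K z - K x"
      using assms y(2) \<open>F \<subseteq> S 0\<close> by (intro peak_le_dom) auto
  qed
  also have "\<dots> = K v - K u" by (rule chain_telescope[OF ch])
  finally show "(case y of (F, xs) \<Rightarrow> \<Sum>(u, t, v)\<leftarrow>xs. peak F u v) \<le> K v - K u" by (simp add: y)
qed

lemma variation_upper:
  assumes "a \<le> u" "v \<le> b" "finite F" "F \<subseteq> S p" "tagged_chain u v xs"
  shows "(\<Sum>(u, t, v)\<leftarrow>xs. peak F u v) \<le> variation p u v"
  unfolding variation_def
  using cSUP_upper[OF _ variation_bdd[OF assms(1,2), of p], of "(F, xs)"] assms(3-) by simp

lemma variation_index_ne:
  assumes "u \<le> v"
  shows "{(F, xs). finite F \<and> F \<subseteq> S p \<and> tagged_chain u v xs} \<noteq> {}"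
proof -
  have "({}, [(u, u, v)]) \<in> {(F, xs). finite F \<and> F \<subseteq> S p \<and> tagged_chain u v xs}"
    using assms by simp
  then show ?thesis by blast
qed

lemma variation_least:
  assumes "u \<le> v"
    and "\<And>F xs. finite F \<Longrightarrow> F \<subseteq> S p \<Longrightarrow> tagged_chain u v xs \<Longrightarrow> (\<Sum>(u, t, v)\<leftarrow>xs. peak F u v) \<le> B"
  shows "variation p u v \<le> B"
  unfolding variation_def by (rule cSUP_least[OF variation_index_ne[OF assms(1)]]) (use assms(2) in auto)

lemma variation_approx:
  assumes "a \<le> u" "u \<le> v" "v \<le> b" "\<eta> > 0"
  obtains F xs where "finite F" "F \<noteq> {}" "F \<subseteq> S p" "tagged_chain u v xs"
    "variation p u v - \<eta> < (\<Sum>(u, t, v)\<leftarrow>xs. peak F u v)"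
proof -
  have "variation p u v - \<eta> < variation p u v" using assms by simp
  then have "\<exists>y\<in>{(F, xs). finite F \<and> F \<subseteq> S p \<and> tagged_chain u v xs}.
    variation p u v - \<eta> < (case y of (F, xs) \<Rightarrow> \<Sum>(u, t, v)\<leftarrow>xs. peak F u v)"
    unfolding variation_def
    by (subst (asm) less_cSUP_iff[OF variation_index_ne[OF assms(2)] variation_bdd[OF assms(1,3)]])
  then obtain y where y: "y \<in> {(F, xs). finite F \<and> F \<subseteq> S p \<and> tagged_chain u v xs}"
    "variation p u v - \<eta> < (case y of (F, xs) \<Rightarrow> \<Sum>(u, t, v)\<leftarrow>xs. peak F u v)" ..
  obtain F xs where yy: "y = (F, xs)" by (cases y)
  obtain i where i: "i \<in> S p" using S_ne by auto
  show thesis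
  proof (rule that[of "insert i F" xs])
    show "variation p u v - \<eta> < (\<Sum>(u, t, v)\<leftarrow>xs. peak (insert i F) u v)"
      using y chain_peak_mono[of "insert i F" F xs] unfolding yy by force
  qed (use y i in \<open>auto simp: yy\<close>)
qed

lemma variation_add:
  assumes "a \<le> u" "u \<le> v" "v \<le> w" "w \<le> b"
  shows "variation p u w = variation p u v + variation p v w"
proof (rule antisym)
  show "variation p u w \<le> variation p u v + variation p v w"
  proof (rule variation_least)
    fix F xs assume F: "finite F" "F \<subseteq> S p" and ch: "tagged_chain u w xs"
    obtain ys zs where c: "tagged_chain u v ys" "tagged_chain v w zs"
      and le: "(\<Sum>(u, t, v)\<leftarrow>xs. peak F u v) \<le> (\<Sum>(u, t, v)\<leftarrow>ys. peak F u v) + (\<Sum>(u, t, v)\<leftarrow>zs. peak F u v)"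
      using chain_split[OF ch assms(2,3,1,4), of "peak F"] peak_triangle[OF F(1)] by blast
    show "(\<Sum>(u, t, v)\<leftarrow>xs. peak F u v) \<le> variation p u v + variation p v w"
      using assms by (intro order_trans[OF le] add_mono variation_upper F c) auto
  qed (use assms in auto)
  show "variation p u v + variation p v w \<le> variation p u w"
  proof (rule field_le_epsilon)
    fix e :: real assume "e > 0"
    then have e2: "e / 2 > 0" by simp
    obtain F1 xs1 where 1: "finite F1" "F1 \<noteq> {}" "F1 \<subseteq> S p" "tagged_chain u v xs1"
      "variation p u v - e / 2 < (\<Sum>(u, t, v)\<leftarrow>xs1. peak F1 u v)"
      using variation_approx[of u v "e / 2" p] assms e2 by auto
    obtain F2 xs2 where 2: "finite F2" "F2 \<noteq> {}" "F2 \<subseteq> S p" "tagged_chain v w xs2"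
      "variation p v w - e / 2 < (\<Sum>(u, t, v)\<leftarrow>xs2. peak F2 u v)"
      using variation_approx[of v w "e / 2" p] assms e2 by auto
    have "(\<Sum>(u, t, v)\<leftarrow>xs1 @ xs2. peak (F1 \<union> F2) u v) \<le> variation p u w"
      using 1 2 assms by (intro variation_upper tagged_chain_append[of _ v]) auto
    moreover have "(\<Sum>(u, t, v)\<leftarrow>xs1. peak F1 u v) \<le> (\<Sum>(u, t, v)\<leftarrow>xs1. peak (F1 \<union> F2) u v)"
      "(\<Sum>(u, t, v)\<leftarrow>xs2. peak F2 u v) \<le> (\<Sum>(u, t, v)\<leftarrow>xs2. peak (F1 \<union> F2) u v)"
      using 1 2 by (auto intro!: chain_peak_mono)
    ultimately show "variation p u v + variation p v w \<le> variation p u w + e"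
      using 1(5) 2(5) by simp
  qed
qed

lemma variation_chain:
  assumes "tagged_chain a b xs"
  shows "(\<Sum>(u, t, v)\<leftarrow>xs. variation p u v) = variation p a b"
proof -
  have "variation p a a = 0" using variation_add[of a a a p] ab by simp
  moreover have "(\<Sum>(u, t, v)\<leftarrow>xs. variation p u v) = (\<Sum>(u, t, v)\<leftarrow>xs. variation p a v - variation p a u)"
  proof (intro arg_cong[of _ _ sum_list] map_cong refl, clarify)
    fix u t v assume "(u, t, v) \<in> set xs"
    from tagged_chain_mem[OF assms this] show "variation p u v = variation p a v - variation p a u"
      using variation_add[of a u v p] by simp
  qed
  ultimately show ?thesis using chain_telescope[OF assms, of "variation p a"] by simp
qed

lemma variation_antimono:
  assumes "a \<le> u" "u \<le> v" "v \<le> b" "p \<le> p'"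
  shows "variation p' u v \<le> variation p u v"
  using assms S_antimono[OF assms(4)] by (intro variation_least variation_upper) auto

lemma peak_le_variation:
  assumes "a \<le> u" "u \<le> v" "v \<le> b" "finite F" "F \<subseteq> S p"
  shows "peak F u v \<le> variation p u v"
  using variation_upper[of u v F p "[(u, u, v)]"] assms by simp

text \<open>A partition \<open>D p\<close> and finitely many indices exhaust the variation for \<open>S p\<close> up to
  \<open>\<epsilon> / 2\<^sup>p\<^sup>+\<^sup>1\<close>. At a tag \<open>t\<close> use a \<open>p\<close> for which all \<open>H i t\<close> with \<open>i \<in> S p\<close> are small, and a gauge
  that keeps the points of \<open>D p\<close> out of the interior of the intervals tagged by \<open>t\<close>. Over such an
  interval the variation is nearly a single integral of some \<open>H i\<close>, hence nearly
  \<open>H i t\<close> times the increment of \<open>g\<close>. Summation bounds the variation for the largest \<open>p\<close> in use.\<close>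

lemma variation_vanishes:
  assumes small: "\<And>t \<epsilon>. t \<in> {a..b} \<Longrightarrow> \<epsilon> > 0 \<Longrightarrow> \<exists>p. \<forall>i\<in>S p. norm (H i t) \<le> \<epsilon>"
    and e: "\<epsilon> > 0"
  shows "\<exists>p. variation p a b \<le> \<epsilon>"
proof -
  have gab: "g a \<le> g b" using mono_onD[OF g] ab by auto
  have main: "\<exists>p. variation p a b \<le> e * (g b - g a + 2)" if e: "e > 0" for e
  proof -
    have "\<forall>t. \<exists>p. t \<in> {a..b} \<longrightarrow> (\<forall>i\<in>S p. norm (H i t) \<le> e)"
      using small[OF _ e] by blast
    from choice[OF this] obtain P where P: "\<And>t i. t \<in> {a..b} \<Longrightarrow> i \<in> S (P t) \<Longrightarrow> norm (H i t) \<le> e"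
      by blast
    have "\<forall>p. \<exists>y. finite (fst y) \<and> fst y \<noteq> {} \<and> fst y \<subseteq> S p \<and> tagged_chain a b (snd y) \<and>
        variation p a b - e / 2 ^ Suc p < (\<Sum>(u, t, v)\<leftarrow>snd y. peak (fst y) u v)"
    proof
      fix p
      have "e / 2 ^ Suc p > 0" using e by simp
      then show "\<exists>y. finite (fst y) \<and> fst y \<noteq> {} \<and> fst y \<subseteq> S p \<and> tagged_chain a b (snd y) \<and>
        variation p a b - e / 2 ^ Suc p < (\<Sum>(u, t, v)\<leftarrow>snd y. peak (fst y) u v)"
        using variation_approx[OF order_refl ab order_refl, of "e / 2 ^ Suc p" p] by (metis fst_conv snd_conv)
    qed
    from choice[OF this] obtain FD where FD: "\<And>p. finite (fst (FD p))" "\<And>p. fst (FD p) \<noteq> {}"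
      "\<And>p. fst (FD p) \<subseteq> S p" "\<And>p. tagged_chain a b (snd (FD p))"
      "\<And>p. variation p a b - e / 2 ^ Suc p < (\<Sum>(u, t, v)\<leftarrow>snd (FD p). peak (fst (FD p)) u v)" by blast
    define F where "F p = fst (FD p)" for p
    define D where "D p = snd (FD p)" for p
    have F: "finite (F p)" "F p \<noteq> {}" "F p \<subseteq> S p" and D: "tagged_chain a b (D p)"
      and approx: "variation p a b - e / 2 ^ Suc p < (\<Sum>(u, t, v)\<leftarrow>D p. peak (F p) u v)" for p
      using FD[of p] by (auto simp: F_def D_def)
    obtain G where G: "\<And>i t. 0 < G i t"
      "\<And>xs \<iota>. tagged_chain a b xs \<Longrightarrow> (\<And>x. x \<in> set xs \<Longrightarrow> fine_at (G (\<iota> x)) x) \<Longrightarrow>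
        (\<Sum>x\<leftarrow>xs. norm (KS_error g (H (\<iota> x)) x)) \<le> e"
      using Saks_Henstock_countable[where H = H, OF ab int e] by blast
    define W where "W p = clipped_sum (peak (F p)) (D p)" for p
    define E where "E p = (snd \<circ> snd) ` set (D p)" for p
    have W1: "W p v - W p u \<le> variation p u v" if "a \<le> u" "u \<le> v" "v \<le> b" for p u v
      unfolding W_def using that F
      by (intro clipped_sum_increment(1)[OF D, of u v a b])
        (auto intro: peak_refl peak_triangle variation_add peak_le_variation[OF _ _ _ F(1,3)])
    have W2: "W p v - W p u \<le> peak (F p) u v"
      if "a \<le> u" "u \<le> v" "v \<le> b" "\<And>s. s \<in> E p \<Longrightarrow> \<not> (u < s \<and> s < v)" for p u v
      unfolding W_def using that F
      by (intro clipped_sum_increment(2)[OF D, of u v a b _ "variation p"])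
        (auto intro: peak_refl peak_triangle variation_add peak_le_variation[OF _ _ _ F(1,3)] simp: E_def)
    have W3: "W p a = 0" "W p b = (\<Sum>(u, t, v)\<leftarrow>D p. peak (F p) u v)" for p
      unfolding W_def by (rule clipped_sum_start[OF D peak_refl] clipped_sum_end[OF D peak_refl])+
    \<comment> \<open>This gauge serves the finitely many functions of the stage \<open>P t\<close> and keeps the other points
      of that stage away from \<open>t\<close>.\<close>
    define \<delta> where "\<delta> t = Min (insert 1 ((\<lambda>i. G i t) ` F (P t) \<union> (\<lambda>s. \<bar>s - t\<bar>) ` (E (P t) - {t})))" for t
    have fin: "finite (insert 1 ((\<lambda>i. G i t) ` F (P t) \<union> (\<lambda>s. \<bar>s - t\<bar>) ` (E (P t) - {t})))" for t
      using F(1) by (simp add: E_def)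
    have dpos: "0 < \<delta> t" for t
      unfolding \<delta>_def by (subst Min_gr_iff[OF fin]) (use G(1) in auto)
    have dG: "\<delta> t \<le> G i t" if "i \<in> F (P t)" for i t
      unfolding \<delta>_def by (rule Min_le[OF fin]) (use that in auto)
    have dE: "\<delta> t \<le> \<bar>s - t\<bar>" if "s \<in> E (P t)" "s \<noteq> t" for s t
      unfolding \<delta>_def by (rule Min_le[OF fin]) (use that in auto)
    obtain xs where xs: "fine_chain \<delta> a b xs"
      and tag: "\<And>u t v. (u, t, v) \<in> set xs \<Longrightarrow> t = u \<or> t = v"
      using fine_chain_exists_endpoint_tags[OF ab, of \<delta>] dpos by blast
    have ch: "tagged_chain a b xs" using xs by (simp add: fine_chain_def)
    define P' where "P' x = P (fst (snd x))" for x :: "real \<times> real \<times> real"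
    define \<iota> where "\<iota> x = (SOME i. i \<in> F (P' x) \<and>
       peak (F (P' x)) (fst x) (snd (snd x)) = norm (KS_int g (H i) (fst x) (snd (snd x))))"
      for x :: "real \<times> real \<times> real"
    have \<iota>: "\<iota> x \<in> F (P' x)"
      "peak (F (P' x)) (fst x) (snd (snd x)) = norm (KS_int g (H (\<iota> x)) (fst x) (snd (snd x)))" for x
    proof -
      have "\<exists>i. i \<in> F (P' x) \<and>
       peak (F (P' x)) (fst x) (snd (snd x)) = norm (KS_int g (H i) (fst x) (snd (snd x)))"
        using peak_attained[OF F(1,2)] by blast
      from someI_ex[OF this] show "\<iota> x \<in> F (P' x)"
        "peak (F (P' x)) (fst x) (snd (snd x)) = norm (KS_int g (H (\<iota> x)) (fst x) (snd (snd x)))"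
        unfolding \<iota>_def by blast+
    qed
    have "fine_at (G (\<iota> x)) x" if "x \<in> set xs" for x
    proof -
      obtain u t v where xx: "x = (u, t, v)" by (cases x)
      have "fine_at \<delta> x" using xs that by (simp add: fine_chain_def)
      moreover have "\<delta> t \<le> G (\<iota> x) t" using \<iota>(1)[of x] by (intro dG) (simp add: xx P'_def)
      ultimately show ?thesis by (auto simp: xx fine_at_def)
    qed
    from G(2)[OF ch this] have err: "(\<Sum>x\<leftarrow>xs. norm (KS_error g (H (\<iota> x)) x)) \<le> e" .
    define ex where "ex p x = (case x of (u, t, v) \<Rightarrow> variation p u v - (W p v - W p u))"
      for p and x :: "real \<times> real \<times> real"
    \<comment> \<open>The variation not seen by single intervals is small.\<close>
    have excess: "(\<Sum>x\<leftarrow>xs. ex (P' x) x) \<le> e"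
    proof (rule sum_list_select_le)
      fix p x assume x: "x \<in> set xs"
      obtain u t v where xx: "x = (u, t, v)" by (cases x)
      show "0 \<le> ex p x"
        using tagged_chain_mem[OF ch x[unfolded xx]] W1[of u v p] by (simp add: ex_def xx)
    next
      fix p
      have "(\<Sum>x\<leftarrow>xs. ex p x) = (\<Sum>(u, t, v)\<leftarrow>xs. variation p u v) - (\<Sum>(u, t, v)\<leftarrow>xs. W p v - W p u)"
        unfolding ex_def by (induction xs) auto
      also have "\<dots> = variation p a b - (\<Sum>(u, t, v)\<leftarrow>D p. peak (F p) u v)"
        unfolding variation_chain[OF ch] chain_telescope[OF ch] W3 by simp
      finally show "(\<Sum>x\<leftarrow>xs. ex p x) \<le> e / 2 ^ Suc p" using approx[of p] by simp
    qed
    define p0 where "p0 = Max (insert 0 (P' ` set xs))"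
    have "variation p0 a b = (\<Sum>(u, t, v)\<leftarrow>xs. variation p0 u v)"
      by (rule variation_chain[OF ch, symmetric])
    also have "\<dots> \<le> (\<Sum>x\<leftarrow>xs. ex (P' x) x + (norm (KS_error g (H (\<iota> x)) x) +
          e * (case x of (u, t, v) \<Rightarrow> g v - g u)))"
    proof (rule sum_list_mono)
      fix x assume x: "x \<in> set xs"
      obtain u t v where xx: "x = (u, t, v)" by (cases x)
      have m: "a \<le> u" "u \<le> t" "t \<le> v" "v \<le> b" using tagged_chain_mem[OF ch x[unfolded xx]] .
      have gv: "g u \<le> g v" using mono_onD[OF g] m by auto
      have "P' x \<le> p0" unfolding p0_def using x by (intro Max_ge) auto
      then have "variation p0 u v \<le> variation (P' x) u v" using m by (intro variation_antimono) auto
      also have "\<dots> = ex (P' x) x + (W (P' x) v - W (P' x) u)" by (simp add: ex_def xx)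
      also have "W (P' x) v - W (P' x) u \<le> peak (F (P' x)) u v"
      proof (rule W2)
        fix s assume s: "s \<in> E (P' x)"
        have f: "t - \<delta> t < u" "v < t + \<delta> t" using xs x by (auto simp: fine_chain_def fine_at_def xx)
        have "s = t \<or> \<delta> t \<le> \<bar>s - t\<bar>" using dE[of s t] s by (auto simp: P'_def xx)
        then show "\<not> (u < s \<and> s < v)" using f tag[OF x[unfolded xx]] m by auto
      qed (use m in auto)
      also have "\<dots> = norm (KS_int g (H (\<iota> x)) u v)" using \<iota>(2)[of x] by (simp add: xx)
      also have "KS_int g (H (\<iota> x)) u v = (g v - g u) *\<^sub>R H (\<iota> x) t - KS_error g (H (\<iota> x)) x"
        by (simp add: KS_error_def xx)
      also have "norm \<dots> \<le> norm ((g v - g u) *\<^sub>R H (\<iota> x) t) + norm (KS_error g (H (\<iota> x)) x)"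
        by (rule norm_triangle_ineq4)
      also have "norm ((g v - g u) *\<^sub>R H (\<iota> x) t) \<le> e * (g v - g u)"
      proof -
        have "norm (H (\<iota> x) t) \<le> e"
          using \<iota>(1)[of x] F(3)[of "P' x"] m by (intro P) (auto simp: P'_def xx)
        from mult_left_mono[OF this, of "g v - g u"] gv show ?thesis by (simp add: mult.commute)
      qed
      finally show "(case x of (u, t, v) \<Rightarrow> variation p0 u v) \<le>
         ex (P' x) x + (norm (KS_error g (H (\<iota> x)) x) + e * (case x of (u, t, v) \<Rightarrow> g v - g u))"
        by (simp add: xx)
    qed
    also have "\<dots> = (\<Sum>x\<leftarrow>xs. ex (P' x) x) + ((\<Sum>x\<leftarrow>xs. norm (KS_error g (H (\<iota> x)) x)) + e * (g b - g a))"
      using chain_telescope[OF ch, of g] by (simp add: sum_list_addf sum_list_const_mult)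
    also have "\<dots> \<le> e * (g b - g a + 2)" using excess err by (simp add: algebra_simps)
    finally show ?thesis by blast
  qed
  show ?thesis using main[of "\<epsilon> / (g b - g a + 2)"] gab e by simp
qed

end

section \<open>A dominated convergence theorem\<close>

text \<open>The majorant is an additive interval function bounding all indefinite integrals, instead of an
  integrable function bounding the integrands. The joint variation of the differences \<open>F m - F n\<close> tends to zero; hence in a Riemann sum
  of the limit each tag may use its own sufficiently late member of the sequence.\<close>

lemma KS_dominated_convergence:
  fixes F :: "nat \<Rightarrow> real \<Rightarrow> 'a::euclidean_space" and K :: "real \<Rightarrow> real"
  assumes ab: "a \<le> b" and g: "mono_on {a..b} g" and intF: "\<And>k. KS_on g (F k) a b"
    and dom: "\<And>k u v. a \<le> u \<Longrightarrow> u \<le> v \<Longrightarrow> v \<le> b \<Longrightarrow> norm (KS_int g (F k) u v) \<le> K v - K u"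
    and lim: "\<And>t. t \<in> {a..b} \<Longrightarrow> (\<lambda>k. F k t) \<longlonglongrightarrow> f t"
  shows "KS_on g f a b" and "(\<lambda>k. KS_int g (F k) a b) \<longlonglongrightarrow> KS_int g f a b"
proof -
  have gab: "g a \<le> g b" using mono_onD[OF g] ab by auto
  let ?H = "\<lambda>(m, n) s. F m s - F n s"
  have Hint: "KS_on g (?H i) u v"
    "KS_int g (?H i) u v = KS_int g (F (fst i)) u v - KS_int g (F (snd i)) u v"
    if "a \<le> u" "u \<le> v" "v \<le> b" for i u v
    using KS_integral_diff[OF that(2) KS_integrable_subinterval[OF intF that] KS_integrable_subinterval[OF intF that],
        of "fst i" "snd i"] by (simp_all add: case_prod_beta)
  interpret dominated_family g a b ?H "\<lambda>p. {p..} \<times> {p..}" "\<lambda>t. 2 * K t"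
  proof
    fix i u v assume uv: "a \<le> u" "u \<le> v" "v \<le> b"
    have "norm (KS_int g (F (fst i)) u v - KS_int g (F (snd i)) u v) \<le> (K v - K u) + (K v - K u)"
      by (intro order_trans[OF norm_triangle_ineq4] add_mono dom uv)
    then show "norm (KS_int g (?H i) u v) \<le> 2 * K v - 2 * K u"
      using Hint(2)[OF uv, of i] by simp
  qed (use ab g Hint in auto)
  have van: "\<exists>p. variation p a b \<le> e" if "e > 0" for e
  proof (rule variation_vanishes[OF _ that])
    fix t \<epsilon> :: real assume t: "t \<in> {a..b}" and "\<epsilon> > 0"
    have "Cauchy (\<lambda>k. F k t)" using lim[OF t] LIMSEQ_imp_Cauchy by blast
    then obtain p where "\<forall>m\<ge>p. \<forall>n\<ge>p. norm (F m t - F n t) < \<epsilon>"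
      using \<open>\<epsilon> > 0\<close> by (meson CauchyD)
    then show "\<exists>p. \<forall>i\<in>{p..} \<times> {p..}. norm (?H i t) \<le> \<epsilon>"
      by (intro exI[of _ p]) (auto intro: less_imp_le)
  qed
  have diff: "(\<Sum>x\<leftarrow>xs. norm (KS_int g (F (m x)) (fst x) (snd (snd x)) - KS_int g (F n) (fst x) (snd (snd x))))
     \<le> variation p a b" if ch: "tagged_chain a b xs" and mp: "\<And>x. x \<in> set xs \<Longrightarrow> m x \<ge> p" and n: "n \<ge> p" for p xs m n
  proof -
    define A where "A = (\<lambda>x. (m x, n)) ` set xs"
    have "(\<Sum>x\<leftarrow>xs. norm (KS_int g (F (m x)) (fst x) (snd (snd x)) - KS_int g (F n) (fst x) (snd (snd x))))
      \<le> (\<Sum>(u, t, v)\<leftarrow>xs. peak A u v)"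
    proof (rule sum_list_mono)
      fix x assume x: "x \<in> set xs"
      obtain u t v where xx: "x = (u, t, v)" by (cases x)
      have mm: "a \<le> u" "u \<le> v" "v \<le> b" using tagged_chain_mem[OF ch x[unfolded xx]] by auto
      have "norm (KS_int g (?H (m x, n)) u v) \<le> peak A u v"
        using x by (intro peak_ge) (auto simp: A_def)
      then show "norm (KS_int g (F (m x)) (fst x) (snd (snd x)) - KS_int g (F n) (fst x) (snd (snd x)))
        \<le> (case x of (u, t, v) \<Rightarrow> peak A u v)"
        using Hint(2)[OF mm, of "(m x, n)"] by (simp add: xx)
    qed
    also have "\<dots> \<le> variation p a b"
      using mp n by (intro variation_upper ch) (auto simp: A_def)
    finally show ?thesis .
  qed
  have "Cauchy (\<lambda>k. KS_int g (F k) a b)"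
  proof (rule CauchyI)
    fix e :: real assume "e > 0"
    then obtain p where p: "variation p a b \<le> e / 2" using van[of "e / 2"] by auto
    have "norm (KS_int g (F m) a b - KS_int g (F n) a b) < e" if "m \<ge> p" "n \<ge> p" for m n
      using diff[of "[(a, a, b)]" p "\<lambda>_. m" n] that p ab \<open>e > 0\<close> by simp
    then show "\<exists>M. \<forall>m\<ge>M. \<forall>n\<ge>M. norm (KS_int g (F m) a b - KS_int g (F n) a b) < e" by blast
  qed
  then obtain I where I: "(\<lambda>k. KS_int g (F k) a b) \<longlonglongrightarrow> I"
    using Cauchy_convergent_iff convergentD by blast
  have main: "\<exists>\<delta>. (\<forall>t. 0 < \<delta> t) \<and> (\<forall>xs. fine_chain \<delta> a b xs \<longrightarrow>
           norm (stieltjes_sum g f xs - I) \<le> e * (g b - g a + 3))" if e: "e > 0" for e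
  proof -
    obtain p where p: "variation p a b \<le> e" using van[OF e] by blast
    obtain n where n: "n \<ge> p" "norm (KS_int g (F n) a b - I) < e"
    proof -
      have "\<forall>\<^sub>F n in sequentially. n \<ge> p \<and> norm (KS_int g (F n) a b - I) < e"
        using tendstoD[OF I e] eventually_ge_at_top[of p] by eventually_elim (simp add: dist_norm)
      then show thesis using that eventually_happens'[OF sequentially_bot] by blast
    qed
    have "\<forall>t. \<exists>m. t \<in> {a..b} \<longrightarrow> m \<ge> p \<and> norm (F m t - f t) \<le> e"
    proof (intro allI)
      fix t
      show "\<exists>m. t \<in> {a..b} \<longrightarrow> m \<ge> p \<and> norm (F m t - f t) \<le> e"
      proof (cases "t \<in> {a..b}")
        case True
        have "\<forall>\<^sub>F m in sequentially. m \<ge> p \<and> norm (F m t - f t) < e"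
          using tendstoD[OF lim[OF True] e] eventually_ge_at_top[of p] by eventually_elim (simp add: dist_norm)
        then show ?thesis using eventually_happens'[OF sequentially_bot] less_imp_le by blast
      qed auto
    qed
    from choice[OF this] obtain m where m: "\<And>t. t \<in> {a..b} \<Longrightarrow> m t \<ge> p"
      "\<And>t. t \<in> {a..b} \<Longrightarrow> norm (F (m t) t - f t) \<le> e" by blast
    obtain G where G: "\<And>i t. 0 < G i t"
      "\<And>xs \<iota>. tagged_chain a b xs \<Longrightarrow> (\<And>x. x \<in> set xs \<Longrightarrow> fine_at (G (\<iota> x)) x) \<Longrightarrow>
        (\<Sum>x\<leftarrow>xs. norm (KS_error g (F (\<iota> x)) x)) \<le> e"
      using Saks_Henstock_countable[where H = F, OF ab intF e] by blast
    have "norm (stieltjes_sum g f xs - I) \<le> e * (g b - g a + 3)"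
      if xs: "fine_chain (\<lambda>t. G (m t) t) a b xs" for xs
    proof -
      have ch: "tagged_chain a b xs" using xs by (simp add: fine_chain_def)
      define \<iota> where "\<iota> x = m (fst (snd x))" for x :: "real \<times> real \<times> real"
      have "fine_at (G (\<iota> x)) x" if "x \<in> set xs" for x
        using xs that by (auto simp: fine_chain_def fine_at_def \<iota>_def split: prod.splits)
      from G(2)[OF ch this] have err: "(\<Sum>x\<leftarrow>xs. norm (KS_error g (F (\<iota> x)) x)) \<le> e" .
      have \<iota>p: "\<iota> x \<ge> p" if "x \<in> set xs" for x
      proof -
        obtain u t v where xx: "x = (u, t, v)" by (cases x)
        show ?thesis using tagged_chain_mem[OF ch that[unfolded xx]] m(1)[of t] by (simp add: xx \<iota>_def)
      qed
      let ?d = "\<lambda>x. KS_int g (F (\<iota> x)) (fst x) (snd (snd x)) - KS_int g (F n) (fst x) (snd (snd x))"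
      have split: "stieltjes_sum g f xs - KS_int g (F n) a b
        = (\<Sum>x\<leftarrow>xs. case x of (u, t, v) \<Rightarrow> (g v - g u) *\<^sub>R f t - KS_int g (F n) u v)"
        unfolding KS_integral_chain[OF ch intF] stieltjes_sum_def
        by (induction xs) auto
      have "norm (stieltjes_sum g f xs - KS_int g (F n) a b)
        \<le> (\<Sum>x\<leftarrow>xs. norm (KS_error g (F (\<iota> x)) x) +
             (norm (?d x) + e * (case x of (u, t, v) \<Rightarrow> g v - g u)))"
        unfolding split
      proof (rule norm_sum_list_le)
        fix x assume x: "x \<in> set xs"
        obtain u t v where xx: "x = (u, t, v)" by (cases x)
        have mm: "a \<le> u" "u \<le> t" "t \<le> v" "v \<le> b" using tagged_chain_mem[OF ch x[unfolded xx]] .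
        have gv: "g u \<le> g v" using mono_onD[OF g] mm by auto
        have eq: "(g v - g u) *\<^sub>R f t - KS_int g (F n) u v = KS_error g (F (\<iota> x)) x +
          (?d x + (g v - g u) *\<^sub>R (f t - F (\<iota> x) t))"
          by (simp add: KS_error_def xx algebra_simps)
        have small: "norm ((g v - g u) *\<^sub>R (f t - F (\<iota> x) t)) \<le> e * (g v - g u)"
        proof -
          have "norm (f t - F (\<iota> x) t) \<le> e" using m(2)[of t] mm by (simp add: \<iota>_def xx norm_minus_commute)
          from mult_left_mono[OF this, of "g v - g u"] gv show ?thesis by (simp add: mult.commute)
        qed
        have "norm ((g v - g u) *\<^sub>R f t - KS_int g (F n) u v)
          \<le> norm (KS_error g (F (\<iota> x)) x) + (norm (?d x) + e * (g v - g u))"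
          unfolding eq by (intro norm_triangle_le add_mono order_refl small)
        then show "norm (case x of (u, t, v) \<Rightarrow> (g v - g u) *\<^sub>R f t - KS_int g (F n) u v)
          \<le> norm (KS_error g (F (\<iota> x)) x) + (norm (?d x) + e * (case x of (u, t, v) \<Rightarrow> g v - g u))"
          by (simp add: xx)
      qed
      also have "\<dots> = (\<Sum>x\<leftarrow>xs. norm (KS_error g (F (\<iota> x)) x)) + ((\<Sum>x\<leftarrow>xs. norm (?d x)) + e * (g b - g a))"
        using chain_telescope[OF ch, of g] by (simp add: sum_list_addf sum_list_const_mult)
      also have "\<dots> \<le> e + (e + e * (g b - g a))"
        using err diff[where m = \<iota>, OF ch \<iota>p n(1)] p by linarith
      finally have 1: "norm (stieltjes_sum g f xs - KS_int g (F n) a b) \<le> e + (e + e * (g b - g a))" .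
      have "norm ((stieltjes_sum g f xs - KS_int g (F n) a b) + (KS_int g (F n) a b - I))
        \<le> (e + (e + e * (g b - g a))) + e"
        using 1 n(2) by (intro norm_triangle_le add_mono) auto
      then show ?thesis by (simp add: algebra_simps)
    qed
    then show ?thesis using G(1) by (intro exI[of _ "\<lambda>t. G (m t) t"]) auto
  qed
  have hasI: "has_KS_integral norm f g a b I"
    unfolding has_KS_integral_iff_chain
  proof (intro allI impI)
    fix \<epsilon> :: real assume \<epsilon>: "\<epsilon> > 0"
    define e where "e = \<epsilon> / (2 * (g b - g a + 3))"
    have pos: "g b - g a + 3 > 0" using gab by simp
    have "e > 0" using \<epsilon> pos by (simp add: e_def)
    have "e * (g b - g a + 3) = \<epsilon> / 2" using pos by (simp add: e_def field_simps)
    with \<epsilon> have "e * (g b - g a + 3) < \<epsilon>" by simp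
    with main[OF \<open>e > 0\<close>] show "\<exists>\<delta>. (\<forall>t. 0 < \<delta> t) \<and>
        (\<forall>xs. fine_chain \<delta> a b xs \<longrightarrow> norm (stieltjes_sum g f xs - I) < \<epsilon>)"
      by (meson le_less_trans)
  qed
  then show "KS_on g f a b" by (auto simp: KS_integrable_def)
  show "(\<lambda>k. KS_int g (F k) a b) \<longlonglongrightarrow> KS_int g f a b"
    using I KS_integral_eqI[OF ab hasI] by simp
qed

section \<open>Equivalence of norms\<close>

lemma is_normD:
  assumes "is_norm N"
  shows "0 \<le> N v" "N v = 0 \<longleftrightarrow> v = 0" "N (c *\<^sub>R v) = \<bar>c\<bar> * N v" "N (u + v) \<le> N u + N v"
    "N (- v) = N v" "N (u - v) \<le> N u + N v" "N (u - v) = N (v - u)"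
proof -
  show "0 \<le> N v" "N v = 0 \<longleftrightarrow> v = 0" "N (u + v) \<le> N u + N v" and sc: "N (c *\<^sub>R v) = \<bar>c\<bar> * N v" for u v c
    using assms by (auto simp: is_norm_def)
  show neg: "N (- v) = N v" for v using sc[of "-1" v] by simp
  show "N (u - v) \<le> N u + N v" using assms neg[of v] by (metis is_norm_def diff_conv_add_uminus)
  show "N (u - v) = N (v - u)" using neg[of "u - v"] by simp
qed

text \<open>The lower constant is the minimum of \<open>N\<close> on the compact Euclidean unit sphere.\<close>

lemma is_norm_equivalent:
  fixes N :: "'a::euclidean_space \<Rightarrow> real"
  assumes N: "is_norm N"
  obtains c C where "0 < c" "0 < C" "\<And>v. c * norm v \<le> N v" "\<And>v. N v \<le> C * norm v"
proof -
  note [simp] = is_normD(1)[OF N]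
  define C where "C = (\<Sum>b\<in>(Basis::'a set). N b) + 1"
  have C1: "C > 0" unfolding C_def by (intro add_nonneg_pos sum_nonneg) auto
  have Nsum: "N (\<Sum>b\<in>B. f b) \<le> (\<Sum>b\<in>B. N (f b))" if "finite B" for B and f :: "'a \<Rightarrow> 'a"
    using that
  proof (induction B rule: finite_induct)
    case empty
    then show ?case using is_normD(2)[OF N, of 0] by simp
  next
    case (insert b B)
    then show ?case using is_normD(4)[OF N, of "f b" "\<Sum>b\<in>B. f b"] by simp
  qed
  have up: "N v \<le> C * norm v" for v
  proof -
    have "N v = N (\<Sum>b\<in>Basis. (v \<bullet> b) *\<^sub>R b)" by (simp add: euclidean_representation)
    also have "\<dots> \<le> (\<Sum>b\<in>Basis. N ((v \<bullet> b) *\<^sub>R b))" by (rule Nsum) simp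
    also have "\<dots> \<le> (\<Sum>b\<in>Basis. norm v * N b)"
      by (intro sum_mono) (auto simp: is_normD(3)[OF N] intro!: mult_right_mono Basis_le_norm)
    also have "\<dots> = norm v * (\<Sum>b\<in>Basis. N b)" by (rule sum_distrib_left[symmetric])
    also have "\<dots> \<le> C * norm v" by (simp add: C_def algebra_simps)
    finally show ?thesis .
  qed
  have "C-lipschitz_on UNIV N"
  proof (rule lipschitz_onI)
    fix x y
    have "N x \<le> N (x - y) + N y" "N y \<le> N (y - x) + N x"
      using is_normD(4)[OF N, of "x - y" y] is_normD(4)[OF N, of "y - x" x] by simp_all
    then have "\<bar>N x - N y\<bar> \<le> N (x - y)" using is_normD(7)[OF N, of x y] by linarith
    then show "dist (N x) (N y) \<le> C * dist x y"
      using up[of "x - y"] by (simp add: dist_norm)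
  qed (use C1 in simp)
  then have cont: "continuous_on (sphere 0 1) N"
    using lipschitz_on_continuous_on continuous_on_subset by blast
  have "sphere (0::'a) 1 \<noteq> {}" using norm_Basis[OF SOME_Basis] by (metis dist_0_norm empty_iff mem_sphere)
  then obtain z where z: "norm z = 1" "\<And>v. norm v = 1 \<Longrightarrow> N z \<le> N v"
    using continuous_attains_inf[OF compact_sphere _ cont] by auto
  have "N z > 0" using z(1) is_normD(1,2)[OF N, of z] by (metis less_eq_real_def norm_zero zero_neq_one)
  moreover have "N z * norm v \<le> N v" for v
  proof (cases "v = 0")
    case False
    have "N z \<le> N ((1 / norm v) *\<^sub>R v)" using False by (intro z(2)) simp
    also have "\<dots> = N v / norm v" by (simp add: is_normD(3)[OF N])
    finally show ?thesis using False by (simp add: field_simps)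
  qed simp
  ultimately show thesis using that[of "N z" C] C1 up by blast
qed

lemma has_KS_integral_norm_le:
  assumes "has_KS_integral N f g a b I" "C > 0" "\<And>v. N' v \<le> C * N v"
  shows "has_KS_integral N' f g a b I"
  unfolding has_KS_integral_iff_chain
proof (intro allI impI)
  fix e :: real assume "e > 0"
  then have "e / C > 0" using assms by simp
  from has_KS_integral_gauge[OF assms(1) this] obtain \<delta> where d: "\<And>t. 0 < \<delta> t"
    "\<And>xs. fine_chain \<delta> a b xs \<Longrightarrow> N (stieltjes_sum g f xs - I) < e / C" by blast
  have "N' (stieltjes_sum g f xs - I) < e" if "fine_chain \<delta> a b xs" for xs
    using d(2)[OF that] assms(3)[of "stieltjes_sum g f xs - I"] assms(2) by (simp add: field_simps)
  with d(1) show "\<exists>\<delta>. (\<forall>t. 0 < \<delta> t) \<and>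
     (\<forall>xs. fine_chain \<delta> a b xs \<longrightarrow> N' (stieltjes_sum g f xs - I) < e)" by blast
qed

lemma KS_norm_independent:
  fixes N :: "'a::euclidean_space \<Rightarrow> real"
  assumes N: "is_norm N"
  shows "KS_integral N = KS_integral norm" "KS_integrable N = KS_integrable norm"
proof -
  obtain c C where c: "0 < c" "0 < C" "\<And>v. c * norm v \<le> N v" "\<And>v. N v \<le> C * norm v"
    using is_norm_equivalent[OF N] by blast
  have "norm v \<le> (1 / c) * N v" for v using c by (simp add: field_simps)
  then have "has_KS_integral N f g a b I \<longleftrightarrow> has_KS_integral norm f g a b I" for f g a b I
    using has_KS_integral_norm_le[of N f g a b I "1 / c" norm]
      has_KS_integral_norm_le[of norm f g a b I C N] c by auto
  then show "KS_integral N = KS_integral norm" "KS_integrable N = KS_integrable norm"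
    by (auto simp: KS_integral_def KS_integrable_def fun_eq_iff)
qed

section \<open>A common majorant for countably many interval functions\<close>

lemma subdivision_extend:
  assumes "subdivision t0 c l \<sigma>" "c < d"
  shows "subdivision t0 d (Suc l) (\<sigma>(Suc l := d))"
    and "(\<Sum>j=1..Suc l. P ((m(Suc l := k)) j) ((\<sigma>(Suc l := d)) (j - 1)) ((\<sigma>(Suc l := d)) j))
       = (\<Sum>j=1..l. P (m j) (\<sigma> (j - 1)) (\<sigma> j)) + (P k c d :: real)"
proof -
  show "subdivision t0 d (Suc l) (\<sigma>(Suc l := d))"
    using assms by (auto simp: subdivision_def le_Suc_eq)
  have "(\<Sum>j=1..l. P ((m(Suc l := k)) j) ((\<sigma>(Suc l := d)) (j - 1)) ((\<sigma>(Suc l := d)) j))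
    = (\<Sum>j=1..l. P (m j) (\<sigma> (j - 1)) (\<sigma> j))"
    by (intro sum.cong) auto
  then show "(\<Sum>j=1..Suc l. P ((m(Suc l := k)) j) ((\<sigma>(Suc l := d)) (j - 1)) ((\<sigma>(Suc l := d)) j))
       = (\<Sum>j=1..l. P (m j) (\<sigma> (j - 1)) (\<sigma> j)) + (P k c d :: real)"
    using assms(1) by (simp add: subdivision_def)
qed

text \<open>Let \<open>K t\<close> be the supremum of the sums over all subdivisions of \<open>[t0, t]\<close>, with a free choice of
  index on each interval. Appending the interval \<open>[c, d]\<close> with index \<open>m\<close> to a subdivision of \<open>[t0, c]\<close>
  shows that \<open>K\<close> grows by at least \<open>P m c d\<close>.\<close>

lemma common_majorant:
  fixes P :: "nat \<Rightarrow> real \<Rightarrow> real \<Rightarrow> real"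
  assumes tb: "t0 \<le> b" and nonneg: "\<And>m c d. t0 \<le> c \<Longrightarrow> c \<le> d \<Longrightarrow> d \<le> b \<Longrightarrow> 0 \<le> P m c d"
    and C: "\<And>l \<sigma> m. subdivision t0 b l \<sigma> \<Longrightarrow> (\<Sum>j=1..l. P (m j) (\<sigma> (j - 1)) (\<sigma> j)) \<le> C"
  obtains K where "\<And>m c d. t0 \<le> c \<Longrightarrow> c < d \<Longrightarrow> d \<le> b \<Longrightarrow> P m c d \<le> K d - K c"
proof -
  define A where "A t = {s. \<exists>l \<sigma> m. subdivision t0 t l \<sigma> \<and> s = (\<Sum>j=1..l. P (m j) (\<sigma> (j - 1)) (\<sigma> j))}" for t
  have ext: "s + P m c d \<in> A d" if s: "s \<in> A c" and cd: "c < d" for s m c d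
  proof -
    obtain l \<sigma> n where *: "subdivision t0 c l \<sigma>" "s = (\<Sum>j=1..l. P (n j) (\<sigma> (j - 1)) (\<sigma> j))"
      using s by (auto simp: A_def)
    show ?thesis
      unfolding A_def *(2) subdivision_extend(2)[OF *(1) cd, of P n m, symmetric]
      using subdivision_extend(1)[OF *(1) cd] by blast
  qed
  have zero: "0 \<in> A t0"
    unfolding A_def by (intro CollectI exI[of _ 0] exI[of _ "\<lambda>_. t0"]) (simp add: subdivision_def)
  have ne: "A t \<noteq> {}" if "t0 \<le> t" for t
    using zero ext[OF zero, of t undefined] that by (cases "t = t0") auto
  have bdd: "bdd_above (A t)" if "t0 \<le> t" "t \<le> b" for t
  proof (rule bdd_aboveI[where M = C])
    fix s assume s: "s \<in> A t"
    show "s \<le> C"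
    proof (cases "t = b")
      case True
      then show ?thesis using s C by (auto simp: A_def)
    next
      case False
      then have "s + P 0 t b \<in> A b" using that by (intro ext s) auto
      then have "s + P 0 t b \<le> C" using C by (auto simp: A_def)
      then show ?thesis using nonneg[of t b 0] that by simp
    qed
  qed
  show thesis
  proof (rule that[of "\<lambda>t. Sup (A t)"])
    fix m c d assume cd: "t0 \<le> c" "c < d" "d \<le> b"
    have "Sup (A c) \<le> Sup (A d) - P m c d"
    proof (rule cSup_least[OF ne[OF cd(1)]])
      fix s assume "s \<in> A c"
      from cSup_upper[OF ext[OF this cd(2)] bdd] show "s \<le> Sup (A d) - P m c d"
        using cd by (simp add: le_diff_eq)
    qed
    then show "P m c d \<le> Sup (A d) - Sup (A c)" by simp
  qed
qed

section \<open>Compactness, regulated functions and uniform limits\<close>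

text \<open>A Helly-type selection principle: the functions are Lipschitz functions of \<open>K t\<close>, with a
  common constant, and \<open>K\<close> has bounded range. Convergence at countably many
  points whose \<open>K\<close>-values are dense in the range of \<open>K\<close> is therefore uniform.\<close>

lemma equivariation_subsequence:
  fixes y :: "nat \<Rightarrow> real \<Rightarrow> 'a::euclidean_space" and K :: "real \<Rightarrow> real"
  assumes ab: "a \<le> b"
    and var: "\<And>k s t. a \<le> s \<Longrightarrow> s \<le> t \<Longrightarrow> t \<le> b \<Longrightarrow> norm (y k t - y k s) \<le> K t - K s"
    and start: "\<And>k. norm (y k a) \<le> B"
  obtains r l where "strict_mono (r :: nat \<Rightarrow> nat)" "uniform_limit {a..b} (\<lambda>j. y (r j)) l sequentially"
proof -
  have K: "K s \<le> K t" if "a \<le> s" "s \<le> t" "t \<le> b" for s t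
    using var[OF that, of 0] norm_ge_zero[of "y 0 t - y 0 s"] by linarith
  have var': "norm (y k t - y k s) \<le> \<bar>K t - K s\<bar>" if "s \<in> {a..b}" "t \<in> {a..b}" for k s t
    using var[of s t k] var[of t s k] that by (cases "s \<le> t") (auto simp: norm_minus_commute)
  have "\<forall>n. \<exists>T. finite T \<and> T \<subseteq> {a..b} \<and> (\<forall>t\<in>{a..b}. \<exists>s\<in>T. \<bar>K t - K s\<bar> < 1 / real (Suc n))"
  proof
    fix n
    have "K ` {a..b} \<subseteq> {K a..K b}" using K by auto
    then have "compact (closure (K ` {a..b}))"
      using bounded_subset[OF bounded_closed_interval] compact_closure by blast
    moreover have "closure (K ` {a..b}) \<subseteq> (\<Union>s\<in>{a..b}. ball (K s) (1 / real (Suc n)))"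
      by (auto simp: closure_approachable)
    ultimately obtain T where "T \<subseteq> {a..b}" "finite T" "closure (K ` {a..b}) \<subseteq> (\<Union>s\<in>T. ball (K s) (1 / real (Suc n)))"
      using compactE_image[of "closure (K ` {a..b})" "{a..b}" "\<lambda>s. ball (K s) (1 / real (Suc n))"] by auto
    moreover have "K ` {a..b} \<subseteq> closure (K ` {a..b})" by (rule closure_subset)
    ultimately show "\<exists>T. finite T \<and> T \<subseteq> {a..b} \<and> (\<forall>t\<in>{a..b}. \<exists>s\<in>T. \<bar>K t - K s\<bar> < 1 / real (Suc n))"
      by (intro exI[of _ T]) (force simp: dist_real_def)
  qed
  from choice[OF this] obtain T where T: "\<And>n. finite (T n)" "\<And>n. T n \<subseteq> {a..b}"
    "\<And>n t. t \<in> {a..b} \<Longrightarrow> \<exists>s\<in>T n. \<bar>K t - K s\<bar> < 1 / real (Suc n)" by blast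
  have bd: "norm (y k t) \<le> B + (K b - K a)" if "t \<in> {a..b}" for k t
    using start[of k] var[of a t k] K[of t b] that norm_triangle_ineq2[of "y k t" "y k a"] by auto
  have "countable (\<Union>n. T n)" using T(1) by (intro countable_UN) (auto intro: countable_finite)
  then obtain r where r: "strict_mono (r::nat\<Rightarrow>nat)" "\<And>s. s \<in> (\<Union>n. T n) \<Longrightarrow> \<exists>l. (\<lambda>n. y (r n) s) \<longlonglongrightarrow> l"
    using function_convergent_subsequence[of "\<Union>n. T n" y "B + (K b - K a)"] bd T(2) by blast
  have "uniformly_Cauchy_on {a..b} (\<lambda>j. y (r j))"
  proof (rule uniformly_Cauchy_onI)
    fix e :: real assume "e > 0"
    then obtain n where n: "1 / real (Suc n) < e / 4"
      using reals_Archimedean[of "e / 4"] by (auto simp: inverse_eq_divide)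
    obtain L where L: "\<And>s. s \<in> T n \<Longrightarrow> (\<lambda>n. y (r n) s) \<longlonglongrightarrow> L s"
      using r(2) by (metis UN_I UNIV_I)
    have "\<forall>\<^sub>F j in sequentially. \<forall>s\<in>T n. dist (y (r j) s) (L s) < e / 4"
      using T(1) \<open>e > 0\<close> by (intro eventually_ball_finite ballI tendstoD L) auto
    then obtain N where N: "\<And>j s. j \<ge> N \<Longrightarrow> s \<in> T n \<Longrightarrow> dist (y (r j) s) (L s) < e / 4"
      by (auto simp: eventually_sequentially)
    have "dist (y (r i) t) (y (r j) t) < e" if t: "t \<in> {a..b}" and ij: "i \<ge> N" "j \<ge> N" for t i j
    proof -
      obtain s where s: "s \<in> T n" "\<bar>K t - K s\<bar> < e / 4" using T(3)[OF t, of n] n by force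
      have "dist (y (r k) t) (y (r k) s) < e / 4" for k
        using var'[of s t "r k"] s T(2)[of n] t by (force simp: dist_norm)
      from this[of i] this[of j] N[OF ij(1) s(1)] N[OF ij(2) s(1)] show ?thesis
        using dist_triangle2[of "y (r i) s" "y (r j) s" "L s"]
          dist_triangle[of "y (r i) t" "y (r j) t" "y (r i) s"]
          dist_triangle[of "y (r i) s" "y (r j) t" "y (r j) s"] dist_commute[of "y (r j) t" "y (r j) s"]
        by linarith
    qed
    then show "\<exists>M. \<forall>x\<in>{a..b}. \<forall>m\<ge>M. \<forall>n\<ge>M. dist (y (r m) x) (y (r n) x) < e" by blast
  qed
  then have "uniformly_convergent_on {a..b} (\<lambda>j. y (r j))"
    by (rule Cauchy_uniformly_convergent)
  then obtain l where "uniform_limit {a..b} (\<lambda>j. y (r j)) l sequentially"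
    by (auto simp: uniformly_convergent_on_def)
  with r(1) show thesis by (rule that)
qed

text \<open>The limits of the \<open>f n\<close> along \<open>F\<close> form a Cauchy sequence, whose limit is that of \<open>h\<close>.\<close>

lemma limit_of_uniform_limit:
  fixes f :: "nat \<Rightarrow> 'x \<Rightarrow> 'a::complete_space"
  assumes F: "F \<noteq> bot" and lim: "\<And>n. (f n \<longlongrightarrow> l n) F"
    and unif: "\<And>e. e > 0 \<Longrightarrow> \<forall>\<^sub>F n in sequentially. \<forall>\<^sub>F s in F. dist (f n s) (h s) < e"
  shows "\<exists>L. (h \<longlongrightarrow> L) F"
proof -
  have "Cauchy l"
  proof (rule metric_CauchyI)
    fix e :: real assume "e > 0"
    then have "\<forall>\<^sub>F n in sequentially. \<forall>\<^sub>F s in F. dist (f n s) (h s) < e / 4" by (intro unif) simp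
    then obtain N where N: "\<And>n. n \<ge> N \<Longrightarrow> \<forall>\<^sub>F s in F. dist (f n s) (h s) < e / 4"
      by (auto simp: eventually_sequentially)
    have "dist (l m) (l n) < e" if "m \<ge> N" "n \<ge> N" for m n
    proof -
      have "\<forall>\<^sub>F s in F. dist (f m s) (f n s) \<le> e / 2"
        using N[OF that(1)] N[OF that(2)]
      proof eventually_elim
        case (elim s)
        then show ?case using dist_triangle2[of "f m s" "f n s" "h s"] by simp
      qed
      then have "dist (l m) (l n) \<le> e / 2"
        by (rule tendsto_upperbound[OF tendsto_dist[OF lim lim] _ F])
      with \<open>e > 0\<close> show ?thesis by simp
    qed
    then show "\<exists>M. \<forall>m\<ge>M. \<forall>n\<ge>M. dist (l m) (l n) < e" by blast
  qed
  then obtain L where L: "l \<longlonglongrightarrow> L" using Cauchy_convergent_iff convergentD by blast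
  have "(h \<longlongrightarrow> L) F"
  proof (rule tendstoI)
    fix e :: real assume "e > 0"
    then have e3: "e / 3 > 0" by simp
    obtain n where n: "\<forall>\<^sub>F s in F. dist (f n s) (h s) < e / 3" "dist (l n) L < e / 3"
      using eventually_happens'[OF sequentially_bot eventually_conj[OF unif[OF e3] tendstoD[OF L e3]]] by blast
    show "\<forall>\<^sub>F s in F. dist (h s) L < e"
      using n(1) tendstoD[OF lim[of n] e3]
    proof eventually_elim
      case (elim s)
      then show ?case
        using n(2) dist_triangle[of "h s" L "f n s"] dist_triangle[of "f n s" L "l n"] dist_commute[of "h s" "f n s"]
        by simp
    qed
  qed
  then show ?thesis by blast
qed

lemma regulated_uniform_limit:
  fixes f :: "nat \<Rightarrow> real \<Rightarrow> 'a::complete_space"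
  assumes reg: "\<And>n. regulated_on a b (f n)" and lim: "uniform_limit {a..b} f h sequentially"
  shows "regulated_on a b h"
proof -
  have *: "\<exists>L. (h \<longlongrightarrow> L) F" if F: "F \<noteq> bot" and ev: "\<forall>\<^sub>F s in F. s \<in> {a..b}"
    and ex: "\<And>n. \<exists>l. (f n \<longlongrightarrow> l) F" for F
  proof -
    obtain l where l: "\<And>n. (f n \<longlongrightarrow> l n) F" using ex by metis
    show ?thesis
    proof (rule limit_of_uniform_limit[OF F l])
      fix e :: real assume "e > 0"
      with lim have "\<forall>\<^sub>F n in sequentially. \<forall>s\<in>{a..b}. dist (f n s) (h s) < e"
        by (auto simp: uniform_limit_iff)
      then show "\<forall>\<^sub>F n in sequentially. \<forall>\<^sub>F s in F. dist (f n s) (h s) < e"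
        by eventually_elim (use ev in \<open>auto elim: eventually_mono\<close>)
    qed
  qed
  show ?thesis
    unfolding regulated_on_def
  proof (intro conjI ballI)
    fix t assume t: "t \<in> {a<..b}"
    have "\<forall>\<^sub>F s in at_left t. s \<in> {a..b}"
      by (rule eventually_at_leftI[of a]) (use t in auto)
    then show "\<exists>l. (h \<longlongrightarrow> l) (at_left t)"
      by (intro * trivial_limit_at_left_real) (use reg t in \<open>auto simp: regulated_on_def\<close>)
  next
    fix t assume t: "t \<in> {a..<b}"
    have "\<forall>\<^sub>F s in at_right t. s \<in> {a..b}"
      by (rule eventually_at_rightI[of _ b]) (use t in auto)
    then show "\<exists>l. (h \<longlongrightarrow> l) (at_right t)"
      by (intro * trivial_limit_at_right_real) (use reg t in \<open>auto simp: regulated_on_def\<close>)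
  qed
qed

text \<open>One-sided limits bound the function near each point; bisection then does the rest.\<close>

lemma regulated_bounded:
  fixes f :: "real \<Rightarrow> 'a::real_normed_vector"
  assumes reg: "regulated_on a b f" and "a \<le> b"
  shows "bounded (f ` {a..b})"
proof -
  have "bounded (f ` ({a..b} \<inter> {a..b}))"
    using \<open>a \<le> b\<close>
  proof (rule Bolzano[where P = "\<lambda>u v. bounded (f ` ({a..b} \<inter> {u..v}))"])
    fix u v w assume *: "bounded (f ` ({a..b} \<inter> {u..v}))" "bounded (f ` ({a..b} \<inter> {v..w}))"
    have "f ` ({a..b} \<inter> {u..w}) \<subseteq> f ` ({a..b} \<inter> {u..v}) \<union> f ` ({a..b} \<inter> {v..w})"
      unfolding image_Un[symmetric] by (intro image_mono) auto
    then show "bounded (f ` ({a..b} \<inter> {u..w}))" using bounded_subset[OF bounded_Un[THEN iffD2]] * by blast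
  next
    fix t assume t: "a \<le> t" "t \<le> b"
    have ev: "\<exists>B. \<forall>\<^sub>F s in F. norm (f s) \<le> B" if lim: "(f \<longlongrightarrow> l) F" for l F
    proof -
      have "\<forall>\<^sub>F s in F. norm (f s) \<le> norm l + 1"
        using tendstoD[OF lim zero_less_one]
      proof eventually_elim
        case (elim s)
        then show ?case using norm_triangle_sub[of "f s" l] by (simp add: dist_norm)
      qed
      then show ?thesis by blast
    qed
    obtain d1 B1 where d1: "d1 > 0" "\<And>s. t - d1 < s \<Longrightarrow> s < t \<Longrightarrow> a \<le> s \<Longrightarrow> norm (f s) \<le> B1"
    proof (cases "t = a")
      case True
      then show thesis using that[of 1 0] by auto
    next
      case False
      then have "t \<in> {a<..b}" using t by auto
      then obtain l where "(f \<longlongrightarrow> l) (at_left t)" using reg unfolding regulated_on_def by blast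
      from ev[OF this] obtain B where "\<forall>\<^sub>F s in at_left t. norm (f s) \<le> B" ..
      then obtain c where "c < t" "\<And>s. c < s \<Longrightarrow> s < t \<Longrightarrow> norm (f s) \<le> B"
        unfolding eventually_at_left_field by auto
      then show thesis using that[of "t - c" B] by auto
    qed
    obtain d2 B2 where d2: "d2 > 0" "\<And>s. t < s \<Longrightarrow> s < t + d2 \<Longrightarrow> s \<le> b \<Longrightarrow> norm (f s) \<le> B2"
    proof (cases "t = b")
      case True
      then show thesis using that[of 1 0] by auto
    next
      case False
      then have "t \<in> {a..<b}" using t by auto
      then obtain l where "(f \<longlongrightarrow> l) (at_right t)" using reg unfolding regulated_on_def by blast
      from ev[OF this] obtain B where "\<forall>\<^sub>F s in at_right t. norm (f s) \<le> B" ..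
      then obtain c where "c > t" "\<And>s. t < s \<Longrightarrow> s < c \<Longrightarrow> norm (f s) \<le> B"
        unfolding eventually_at_right_field by auto
      then show thesis using that[of "c - t" B] by auto
    qed
    show "\<exists>d>0. \<forall>u v. u \<le> t \<and> t \<le> v \<and> v - u < d \<longrightarrow> bounded (f ` ({a..b} \<inter> {u..v}))"
    proof (intro exI[of _ "min d1 d2"] conjI allI impI)
      fix u v assume uv: "u \<le> t \<and> t \<le> v \<and> v - u < min d1 d2"
      have "norm (f s) \<le> max (norm (f t)) (max B1 B2)" if "s \<in> {a..b} \<inter> {u..v}" for s
        using d1(2)[of s] d2(2)[of s] that uv by (cases s t rule: linorder_cases) auto
      then show "bounded (f ` ({a..b} \<inter> {u..v}))" unfolding bounded_iff by blast
    qed (use d1 d2 in auto)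
  qed
  then show ?thesis by simp
qed

lemma uniform_limit_subseq:
  assumes "uniform_limit S f l sequentially" "strict_mono (r :: nat \<Rightarrow> nat)"
  shows "uniform_limit S (\<lambda>j. f (r j)) l sequentially"
proof (rule uniform_limitI)
  fix e :: real assume "e > 0"
  from eventually_subseq[OF assms(2) uniform_limitD[OF assms(1) this]]
  show "\<forall>\<^sub>F j in sequentially. \<forall>x\<in>S. dist (f (r j) x) (l x) < e" .
qed

text \<open>Two members of the sequence differ by \<open>\<rho>\<close> with \<open>\<rho> \<le> \<phi> j \<rho> + \<delta>\<close>, where \<open>\<delta>\<close> collects the
  differences of the data. The uniform gap between \<open>\<phi> j\<close> and the identity forbids this
  for \<open>\<rho>\<close> in any compact subset of the positive half-line once \<open>\<delta>\<close> is small.\<close>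

lemma fixed_points_uniform_limit:
  fixes x w :: "nat \<Rightarrow> real \<Rightarrow> 'a::euclidean_space" and N :: "'a \<Rightarrow> real"
  assumes N: "is_norm N"
    and eq: "\<And>j t. t \<in> J \<Longrightarrow> x j t = w j t + H j t (x j t)"
    and w: "uniform_limit J w w' sequentially"
    and B: "bounded B" and xB: "\<And>j t. t \<in> J \<Longrightarrow> x j t \<in> B"
    and H: "uniform_limit (J \<times> B) (\<lambda>j (t, u). H j t u) (\<lambda>(t, u). h t u) sequentially"
    and contr: "\<And>j t u v. t \<in> J \<Longrightarrow> N (H j t u - H j t v) \<le> \<phi> j (N (u - v))"
    and gap: "\<And>c d. 0 < c \<Longrightarrow> c < d \<Longrightarrow> \<exists>\<delta>>0. \<forall>t\<in>{c..d}. \<forall>j. \<phi> j t < t - \<delta>"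
  obtains x' where "uniform_limit J x x' sequentially"
proof -
  obtain c C where c: "0 < c" "0 < C" "\<And>v. c * norm v \<le> N v" "\<And>v. N v \<le> C * norm v"
    using is_norm_equivalent[OF N] by blast
  obtain b where b: "\<And>u. u \<in> B \<Longrightarrow> norm u \<le> b" using B by (auto simp: bounded_iff)
  have "uniformly_Cauchy_on J x"
  proof (rule uniformly_Cauchy_onI)
    fix e :: real assume "e > 0"
    \<comment> \<open>No two values in \<open>B\<close> have \<open>N\<close>-distance more than \<open>d\<close>. The interval on which the gap is used
      extends to \<open>max (c * e) d + 1\<close> to be nondegenerate in every case.\<close>
    define d where "d = C * (2 * b)"
    have "0 < c * e" using \<open>e > 0\<close> c by simp
    then have "0 < c * e" "c * e < max (c * e) d + 1" by auto
    from gap[OF this] obtain \<delta> where \<delta>: "\<delta> > 0" "\<And>s j. s \<in> {c * e..max (c * e) d + 1} \<Longrightarrow> \<phi> j s < s - \<delta>"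
      by blast
    have pos: "\<delta> / (4 * C) > 0" using \<delta> c by simp
    have "\<forall>\<^sub>F j in sequentially. (\<forall>t\<in>J. dist (w j t) (w' t) < \<delta> / (4 * C)) \<and>
       (\<forall>t\<in>J. \<forall>u\<in>B. dist (H j t u) (h t u) < \<delta> / (4 * C))"
      using uniform_limitD[OF w pos] uniform_limitD[OF H pos] by eventually_elim auto
    then obtain M where M: "\<And>j t. j \<ge> M \<Longrightarrow> t \<in> J \<Longrightarrow> dist (w j t) (w' t) < \<delta> / (4 * C)"
      "\<And>j t u. j \<ge> M \<Longrightarrow> t \<in> J \<Longrightarrow> u \<in> B \<Longrightarrow> dist (H j t u) (h t u) < \<delta> / (4 * C)"
      unfolding eventually_sequentially by blast
    have "dist (x i t) (x j t) < e" if t: "t \<in> J" and ij: "i \<ge> M" "j \<ge> M" for t i j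
    proof (rule ccontr)
      assume "\<not> dist (x i t) (x j t) < e"
      define \<rho> where "\<rho> = N (x i t - x j t)"
      have "c * e \<le> \<rho>"
        using c(3)[of "x i t - x j t"] \<open>\<not> dist (x i t) (x j t) < e\<close> c(1) unfolding \<rho>_def dist_norm
        by (smt (verit) mult_left_mono)
      moreover have "\<rho> \<le> C * (2 * b)"
      proof -
        have "norm (x i t - x j t) \<le> b + b"
          by (intro order_trans[OF norm_triangle_ineq4] add_mono b xB t)
        then show ?thesis using c(4)[of "x i t - x j t"] mult_left_mono[of _ "2 * b" C] c(2)
          unfolding \<rho>_def by (smt (verit))
      qed
      ultimately have "\<phi> i \<rho> < \<rho> - \<delta>" using \<open>0 < c * e\<close> by (intro \<delta>) (auto simp: d_def)
      moreover have "\<rho> \<le> \<phi> i \<rho> + \<delta>"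
      proof -
        have dw: "dist (w i t) (w j t) < \<delta> / (2 * C)"
          using M(1)[OF ij(1) t] M(1)[OF ij(2) t] dist_triangle2[of "w i t" "w j t" "w' t"] by simp
        have dH: "dist (H i t (x j t)) (H j t (x j t)) < \<delta> / (2 * C)"
          using M(2)[OF ij(1) t xB[OF t, of j]] M(2)[OF ij(2) t xB[OF t, of j]]
            dist_triangle2[of "H i t (x j t)" "H j t (x j t)" "h t (x j t)"] by simp
        have small: "N (u - v) \<le> \<delta> / 2" if "dist u v < \<delta> / (2 * C)" for u v
          using c(4)[of "u - v"] that c(2) by (simp add: dist_norm field_simps)
        have "x i t - x j t = (H i t (x i t) - H i t (x j t)) +
           ((w i t - w j t) + (H i t (x j t) - H j t (x j t)))"
          using eq[OF t, of i] eq[OF t, of j] by (simp add: algebra_simps)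
        then have "\<rho> \<le> N (H i t (x i t) - H i t (x j t)) +
           (N (w i t - w j t) + N (H i t (x j t) - H j t (x j t)))"
          unfolding \<rho>_def using is_normD(4)[OF N] by (smt (verit))
        also have "\<dots> \<le> \<phi> i \<rho> + (\<delta> / 2 + \<delta> / 2)"
          unfolding \<rho>_def by (intro add_mono contr t small dw dH)
        finally show ?thesis by simp
      qed
      ultimately show False by simp
    qed
    then show "\<exists>M. \<forall>t\<in>J. \<forall>m\<ge>M. \<forall>n\<ge>M. dist (x m t) (x n t) < e" by blast
  qed
  then have "uniformly_convergent_on J x" by (rule Cauchy_uniformly_convergent)
  then show thesis using that by (auto simp: uniformly_convergent_on_def)
qed

section \<open>Convergence of the solutions\<close>

theorem theorem5p1:
  fixes nrm :: "real ^ 'n \<Rightarrow> real"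
    and t0 a :: real
    and g :: "real \<Rightarrow> real"
    and h f :: "real \<Rightarrow> real ^ 'n \<Rightarrow> real ^ 'n"
    and x0 :: "real ^ 'n"
    and hk fk :: "nat \<Rightarrow> real \<Rightarrow> real ^ 'n \<Rightarrow> real ^ 'n"
    and \<phi> :: "nat \<Rightarrow> real \<Rightarrow> real"
    and Mk :: "nat \<Rightarrow> real \<Rightarrow> real"
    and M :: "real \<Rightarrow> real"
    and xhat :: "nat \<Rightarrow> real ^ 'n"
    and xk :: "nat \<Rightarrow> real \<Rightarrow> real ^ 'n"
  assumes norm: "is_norm nrm"
    and a_pos: "a > 0"
    and g_mono: "mono_on {t0..t0 + a} g"
    and g_left: "\<And>t. t \<in> {t0<..t0 + a} \<Longrightarrow> continuous (at_left t) g"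
    and f_cont: "\<And>t. t \<in> {t0..t0 + a} \<Longrightarrow> continuous_on UNIV (f t)"
    and f_int: "\<And>u. KS_integrable nrm (\<lambda>s. f s u) g t0 (t0 + a)"
    and Mk_nonneg: "\<And>k t. t \<in> {t0..t0 + a} \<Longrightarrow> 0 \<le> Mk k t"
    and A0: "\<And>k t. t \<in> {t0..t0 + a} \<Longrightarrow> continuous_on UNIV (fk k t)"
    and A1: "\<And>k u. KS_integrable nrm (\<lambda>s. fk k s u) g t0 (t0 + a)"
    and A2_int: "\<And>k. KS_integrable abs (Mk k) g t0 (t0 + a)"
    and A2_bound: "\<And>k u c d. t0 \<le> c \<Longrightarrow> c \<le> d \<Longrightarrow> d \<le> t0 + a \<Longrightarrow>
          nrm (KS_integral nrm (\<lambda>s. fk k s u) g c d) \<le> KS_integral abs (Mk k) g c d"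
    and A3_reg: "\<And>k v. regulated_on t0 (t0 + a) (\<lambda>t. hk k t v)"
    and A3_D: "\<And>k. D_function (\<phi> k)"
    and A3_less: "\<And>k t. t > 0 \<Longrightarrow> \<phi> k t < t"
    and A3_contr: "\<And>k t u v. t \<in> {t0..t0 + a} \<Longrightarrow>
          nrm (hk k t u - hk k t v) \<le> \<phi> k (nrm (u - v))"
    and I: "\<And>c d. 0 < c \<Longrightarrow> c < d \<Longrightarrow> \<exists>\<delta>>0. \<forall>t\<in>{c..d}. \<forall>k. \<phi> k t < t - \<delta>"
    and sol: "\<And>k. is_solution nrm g t0 a (hk k) (fk k) (xhat k) (xk k)"
    and i: "xhat \<longlonglongrightarrow> x0"
    and ii: "\<And>B. bounded B \<Longrightarrow>
          uniform_limit ({t0..t0 + a} \<times> B) (\<lambda>k (t, u). hk k t u) (\<lambda>(t, u). h t u) sequentially"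
    and iii_f: "\<And>t B. t \<in> {t0..t0 + a} \<Longrightarrow> bounded B \<Longrightarrow>
          uniform_limit B (\<lambda>k u. fk k t u) (\<lambda>u. f t u) sequentially"
    and M_nonneg: "\<And>t. t \<in> {t0..t0 + a} \<Longrightarrow> 0 \<le> M t"
    and iii_M: "\<And>t. t \<in> {t0..t0 + a} \<Longrightarrow> (\<lambda>k. Mk k t) \<longlonglongrightarrow> M t"
    and iii_C: "\<exists>C>0. \<forall>l \<sigma> (m :: nat \<Rightarrow> nat). subdivision t0 (t0 + a) l \<sigma> \<longrightarrow>
          (\<Sum>j=1..l. KS_integral abs (Mk (m j)) g (\<sigma> (j - 1)) (\<sigma> j)) \<le> C"
    and R: "\<exists>R>0. liminf (\<lambda>k. SUP r\<in>{R..}. ereal (\<phi> k r / r)) < 1"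
  shows "\<exists>r x. strict_mono r \<and>
           uniform_limit {t0..t0 + a} (\<lambda>j. xk (r j)) x sequentially \<and>
           is_solution nrm g t0 a h f x0 x"
proof -
  define J where "J = {t0..t0 + a}"
  have tb: "t0 \<le> t0 + a" using a_pos by simp
  have t0J: "t0 \<in> J" using tb by (simp add: J_def)
  note N = is_normD[OF norm]
  note KS_eq = KS_norm_independent[OF norm]
  obtain c C where c: "0 < c" "0 < C" "\<And>v. c * norm v \<le> nrm v" "\<And>v. nrm v \<le> C * norm v"
    using is_norm_equivalent[OF norm] by blast
  have c': "norm v \<le> nrm v / c" for v using c(3)[of v] c(1) by (simp add: field_simps)

  \<comment> \<open>A common majorant, rescaled from the given norm to the standard one.\<close>
  obtain C0 where C0: "\<And>l \<sigma> (m :: nat \<Rightarrow> nat). subdivision t0 (t0 + a) l \<sigma> \<Longrightarrow>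
          (\<Sum>j=1..l. KS_integral abs (Mk (m j)) g (\<sigma> (j - 1)) (\<sigma> j)) \<le> C0"
    using iii_C by blast
  have M_int_nonneg: "0 \<le> KS_integral abs (Mk k) g u v" if "t0 \<le> u" "u \<le> v" "v \<le> t0 + a" for k u v
    using A2_bound[OF that] N(1) order_trans by blast
  obtain K0 where K0: "\<And>m u v. t0 \<le> u \<Longrightarrow> u < v \<Longrightarrow> v \<le> t0 + a \<Longrightarrow>
      KS_integral abs (Mk m) g u v \<le> K0 v - K0 u"
    using common_majorant[of t0 "t0 + a" "\<lambda>m. KS_integral abs (Mk m) g" C0, OF tb M_int_nonneg C0] by blast
  define K where "K t = K0 t / c" for t
  have frozen: "norm (KS_int g (\<lambda>s. fk k s u) p q) \<le> K q - K p"
    if "t0 \<le> p" "p \<le> q" "q \<le> t0 + a" for k u p q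
  proof (cases "p = q")
    case False
    then have "KS_integral abs (Mk k) g p q \<le> K0 q - K0 p" using that by (intro K0) auto
    with A2_bound[OF that, of k u] have "nrm (KS_int g (\<lambda>s. fk k s u) p q) \<le> K0 q - K0 p"
      by (simp add: KS_eq)
    then have "nrm (KS_int g (\<lambda>s. fk k s u) p q) / c \<le> (K0 q - K0 p) / c"
      using c(1) by (intro divide_right_mono) auto
    with c'[of "KS_int g (\<lambda>s. fk k s u) p q"] show ?thesis by (simp add: K_def diff_divide_distrib)
  qed simp

  have x_int: "KS_on g (\<lambda>s. fk k s (xk k s)) t0 (t0 + a)" for k
    using sol[of k] tb by (simp add: is_solution_def KS_eq)
  have curve: "norm (KS_int g (\<lambda>s. fk k s (xk k s)) p q) \<le> K q - K p"
    if "t0 \<le> p" "p \<le> q" "q \<le> t0 + a" for k p q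
  proof (rule KS_integral_superposition_bound[where F = "fk k" and z = "xk k" and K = K, OF that(2)])
    show "mono_on {p..q} g" using g_mono by (rule mono_on_subset) (use that in auto)
    show "KS_on g (\<lambda>s. fk k s u) p q" for u
      using KS_integrable_subinterval[OF A1[of k u, unfolded KS_eq] that] .
    show "KS_on g (\<lambda>s. fk k s (xk k s)) p q"
      using KS_integrable_subinterval[OF x_int that] .
  qed (use A0 frozen that in auto)
  define y where "y k t = KS_int g (\<lambda>s. fk k s (xk k s)) t0 t" for k t
  have y_var: "norm (y k t - y k s) \<le> K t - K s" if "t0 \<le> s" "s \<le> t" "t \<le> t0 + a" for k s t
  proof -
    have "KS_on g (\<lambda>s. fk k s (xk k s)) t0 t"
      using that by (intro KS_integrable_subinterval[OF x_int]) auto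
    from KS_integral_combine[OF this that(1,2)] show ?thesis
      using curve[OF that] by (simp add: y_def)
  qed
  have y_t0: "y k t0 = 0" for k by (simp add: y_def)
  have x_t0: "xk k t0 = xhat k" for k using sol[of k] by (simp add: is_solution_def)
  have x_eq: "xk k t = xhat k - hk k t0 (xhat k) + hk k t (xk k t) + y k t" if "t \<in> J" for k t
  proof -
    have "xk k t = xhat k - hk k t0 (xk k t0) + hk k t (xk k t) + KS_int g (\<lambda>s. fk k s (xk k s)) t0 t"
      using sol[of k] that unfolding is_solution_def KS_eq J_def by blast
    then show ?thesis unfolding x_t0 y_def .
  qed
  have x_reg: "regulated_on t0 (t0 + a) (xk k)" and hx_reg: "regulated_on t0 (t0 + a) (\<lambda>t. hk k t (xk k t))" for k
    using sol[of k] by (auto simp: is_solution_def)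
  have contr: "nrm (hk k t u - hk k t v) \<le> \<phi> k (nrm (u - v))" if "t \<in> J" for k t u v
    using A3_contr that by (simp add: J_def)
  have phi_le: "\<phi> k s \<le> s" if "s \<ge> 0" for k s
    using A3_less[of s k] A3_D[of k] that by (cases "s = 0") (auto simp: D_function_def)
  have nonexp: "norm (hk k t u - hk k t v) \<le> nrm (u - v) / c" if "t \<in> J" for k t u v
    using c'[of "hk k t u - hk k t v"] contr[OF that, of k u v] phi_le[OF N(1)[of "u - v"], of k] c(1)
    by (meson divide_right_mono less_imp_le order_trans)

  \<comment> \<open>Bounding the solutions: for infinitely many \<open>k\<close> the graph of \<open>\<phi> k\<close> lies below a line of slope
    \<open>q < 1\<close> beyond \<open>R0\<close>.\<close>
  obtain R0 where R0: "R0 > 0" "liminf (\<lambda>k. SUP r\<in>{R0..}. ereal (\<phi> k r / r)) < 1" using R by blast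
  obtain q :: real where q: "liminf (\<lambda>k. SUP r\<in>{R0..}. ereal (\<phi> k r / r)) < ereal q" "ereal q < 1"
    using ereal_dense2[OF R0(2)] by blast
  have freq: "\<exists>\<^sub>F k in sequentially. (SUP r\<in>{R0..}. ereal (\<phi> k r / r)) < ereal q"
  proof (rule ccontr)
    assume "\<not> ?thesis"
    then have "\<forall>\<^sub>F k in sequentially. ereal q \<le> (SUP r\<in>{R0..}. ereal (\<phi> k r / r))"
      by (simp add: not_frequently not_less)
    from Liminf_bounded[OF this] q(1) show False by simp
  qed
  obtain k0 B0 where B0: "\<And>k t. k \<ge> k0 \<Longrightarrow> t \<in> J \<Longrightarrow> norm (hk k t x0) \<le> B0"
  proof -
    have "bounded {x0}" by simp
    from uniform_limitD[OF ii[OF this] zero_less_one]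
    obtain k0 where k0: "\<And>k t. k \<ge> k0 \<Longrightarrow> t \<in> J \<Longrightarrow> dist (hk k t x0) (h t x0) < 1"
      unfolding eventually_sequentially J_def by fastforce
    obtain B1 where B1: "\<And>t. t \<in> J \<Longrightarrow> norm (hk k0 t x0) \<le> B1"
      using regulated_bounded[OF A3_reg[of k0 x0] tb] unfolding bounded_iff J_def by blast
    have "norm (hk k t x0) \<le> B1 + 2" if "k \<ge> k0" "t \<in> J" for k t
    proof -
      have "dist (hk k t x0) (hk k0 t x0) < 2"
        using k0[OF that] k0[OF order_refl that(2)] dist_triangle2[of "hk k t x0" "hk k0 t x0" "h t x0"] by linarith
      then show ?thesis
        using B1[OF that(2)] norm_triangle_ineq2[of "hk k t x0" "hk k0 t x0"] by (simp add: dist_norm)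
    qed
    then show thesis by (rule that)
  qed
  have "\<exists>\<^sub>F k in sequentially. (SUP r\<in>{R0..}. ereal (\<phi> k r / r)) < ereal q \<and> k \<ge> k0"
    using freq eventually_ge_at_top[of k0] by (rule frequently_eventually_frequently)
  then have "infinite {k. (SUP r\<in>{R0..}. ereal (\<phi> k r / r)) < ereal q \<and> k \<ge> k0}"
    by (simp add: frequently_cofinite[symmetric] cofinite_eq_sequentially)
  from infinite_enumerate[OF this] obtain r1 :: "nat \<Rightarrow> nat" where r1: "strict_mono r1"
    "\<And>j. (SUP r\<in>{R0..}. ereal (\<phi> (r1 j) r / r)) < ereal q" "\<And>j. r1 j \<ge> k0" by blast
  have slope: "\<phi> (r1 j) s \<le> q * s" if "s \<ge> R0" for j s
  proof -
    have "ereal (\<phi> (r1 j) s / s) \<le> (SUP r\<in>{R0..}. ereal (\<phi> (r1 j) r / r))"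
      using that by (intro SUP_upper) auto
    also have "\<dots> < ereal q" by (rule r1(2))
    finally have "\<phi> (r1 j) s / s < q" by simp
    then show ?thesis using that R0(1) by (simp add: field_simps)
  qed
  have q1: "q < 1" using q(2) by simp

  obtain Bx where Bx: "\<And>k. norm (xhat k) \<le> Bx"
    using convergent_imp_Bseq[OF convergentI[OF i]] by (auto simp: Bseq_def)
  define A1' where "A1' = C * (B0 + C * (Bx + norm x0) / c)"
  define A2' where "A2' = 2 * A1' + C * (K (t0 + a) - K t0)"
  define A3' where "A3' = max R0 (A2' / (1 - q)) / c + Bx"
  \<comment> \<open>The distance \<open>\<rho>\<close> of \<open>xk (r1 j) t\<close> from the initial value satisfies \<open>\<rho> \<le> \<phi> (r1 j) \<rho> + A2'\<close>.\<close>
  have x_bd: "norm (xk (r1 j) t) \<le> A3'" if t: "t \<in> J" for j t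
  proof -
    let ?k = "r1 j"
    have h_bd: "nrm (hk ?k s (xhat ?k)) \<le> A1'" if "s \<in> J" for s
    proof -
      have "norm (xhat ?k - x0) \<le> Bx + norm x0"
        by (rule order_trans[OF norm_triangle_ineq4]) (simp add: Bx)
      then have "nrm (xhat ?k - x0) \<le> C * (Bx + norm x0)"
        using c(4)[of "xhat ?k - x0"] c(2) by (meson less_imp_le mult_left_mono order_trans)
      then have "norm (hk ?k s (xhat ?k) - hk ?k s x0) \<le> C * (Bx + norm x0) / c"
        using nonexp[OF that, of ?k "xhat ?k" x0] c(1) by (meson divide_right_mono less_imp_le order_trans)
      then have "norm (hk ?k s (xhat ?k)) \<le> B0 + C * (Bx + norm x0) / c"
        using B0[OF r1(3)[of j] that] norm_triangle_ineq2[of "hk ?k s (xhat ?k)" "hk ?k s x0"] by linarith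
      then show ?thesis
        unfolding A1'_def using c(4)[of "hk ?k s (xhat ?k)"] c(2) by (meson less_imp_le mult_left_mono order_trans)
    qed
    define \<rho> where "\<rho> = nrm (xk ?k t - xhat ?k)"
    have y_bd: "nrm (y ?k t) \<le> C * (K (t0 + a) - K t0)"
    proof -
      have tt: "t0 \<le> t" "t \<le> t0 + a" using t by (auto simp: J_def)
      have "norm (y ?k t) \<le> K t - K t0" using y_var[OF order_refl tt, of ?k] y_t0 by simp
      moreover have "K t \<le> K (t0 + a)"
        using y_var[OF tt order_refl, of ?k] norm_ge_zero[of "y ?k (t0 + a) - y ?k t"] by linarith
      ultimately have "norm (y ?k t) \<le> K (t0 + a) - K t0" by linarith
      then show ?thesis using c(4)[of "y ?k t"] c(2) by (meson less_imp_le mult_left_mono order_trans)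
    qed
    have "xk ?k t - xhat ?k = (hk ?k t (xk ?k t) - hk ?k t (xhat ?k)) +
        ((hk ?k t (xhat ?k) - hk ?k t0 (xhat ?k)) + y ?k t)"
      using x_eq[OF t, of ?k] by (simp add: algebra_simps)
    then have "\<rho> \<le> nrm (hk ?k t (xk ?k t) - hk ?k t (xhat ?k)) +
        ((nrm (hk ?k t (xhat ?k)) + nrm (hk ?k t0 (xhat ?k))) + nrm (y ?k t))"
      unfolding \<rho>_def using N(4) N(6) by (smt (verit))
    also have "\<dots> \<le> \<phi> ?k \<rho> + ((A1' + A1') + C * (K (t0 + a) - K t0))"
      unfolding \<rho>_def by (intro add_mono contr t h_bd t0J y_bd)
    finally have le: "\<rho> \<le> \<phi> ?k \<rho> + A2'" by (simp add: A2'_def)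
    have "\<rho> \<le> max R0 (A2' / (1 - q))"
    proof (cases "\<rho> \<ge> R0")
      case True
      from le slope[OF True, of j] have "\<rho> * (1 - q) \<le> A2'" by (simp add: algebra_simps)
      then have "\<rho> \<le> A2' / (1 - q)" using q1 by (simp add: field_simps)
      then show ?thesis by simp
    qed auto
    then have "norm (xk ?k t - xhat ?k) \<le> max R0 (A2' / (1 - q)) / c"
      using c'[of "xk ?k t - xhat ?k"] c(1) unfolding \<rho>_def by (meson divide_right_mono less_imp_le order_trans)
    then show ?thesis
      using Bx[of ?k] norm_triangle_sub[of "xk ?k t" "xhat ?k"] unfolding A3'_def by linarith
  qed

  obtain r2 y' where r2: "strict_mono (r2 :: nat \<Rightarrow> nat)"
    and y': "uniform_limit {t0..t0 + a} (\<lambda>j. y (r1 (r2 j))) y' sequentially"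
    using equivariation_subsequence[OF tb, of "\<lambda>j. y (r1 j)" K 0] y_var y_t0 by auto
  define r where "r j = r1 (r2 j)" for j
  have r: "strict_mono r" using r1(1) r2 by (simp add: r_def strict_mono_def)
  define B where "B = cball (0 :: real ^ 'n) A3'"
  have B: "bounded B" by (simp add: B_def)
  have xB: "xk (r j) t \<in> B" if "t \<in> J" for j t
    using x_bd[OF that] by (simp add: B_def r_def)
  have xhat_r: "(\<lambda>j. xhat (r j)) \<longlonglongrightarrow> x0"
    using LIMSEQ_subseq_LIMSEQ[OF i r] by (simp add: o_def)
  have h_lim: "uniform_limit (J \<times> S) (\<lambda>j (t, u). hk (r j) t u) (\<lambda>(t, u). h t u) sequentially"
    if "bounded S" for S
    using uniform_limit_subseq[OF ii[OF that] r] by (simp add: J_def)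
  \<comment> \<open>The maps \<open>hk (r j) t\<close> have a common Lipschitz constant, so their arguments may converge as well.\<close>
  have h_conv: "(\<lambda>j. hk (r j) t (u j)) \<longlonglongrightarrow> h t v" if t: "t \<in> J" and u: "u \<longlonglongrightarrow> v" for t u v
  proof -
    have lim: "(\<lambda>j. hk (r j) t v) \<longlonglongrightarrow> h t v"
      using tendsto_uniform_limitI[OF h_lim[of "{v}"], of "(t, v)"] t by simp
    have "(\<lambda>j. hk (r j) t (u j) - hk (r j) t v) \<longlonglongrightarrow> 0"
    proof (rule tendsto_0_le[of "\<lambda>j. u j - v" sequentially _ "C / c"])
      show "(\<lambda>j. u j - v) \<longlonglongrightarrow> 0" using u by (simp add: LIM_zero)
      have "norm (hk (r j) t (u j) - hk (r j) t v) \<le> norm (u j - v) * (C / c)" for j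
      proof -
        have "nrm (u j - v) / c \<le> C * norm (u j - v) / c" using c by (intro divide_right_mono) auto
        with nonexp[OF t, of "r j" "u j" v] show ?thesis by (simp add: mult.commute)
      qed
      then show "\<forall>\<^sub>F j in sequentially. norm (hk (r j) t (u j) - hk (r j) t v) \<le> norm (u j - v) * (C / c)"
        by simp
    qed
    from tendsto_add[OF this lim] show ?thesis by simp
  qed
  define w where "w j t = xhat (r j) - hk (r j) t0 (xhat (r j)) + y (r j) t" for j t
  define w' where "w' t = x0 - h t0 x0 + y' t" for t
  have w: "uniform_limit J w w' sequentially"
    unfolding w_def w'_def
  proof (rule uniform_limit_add)
    have "(\<lambda>j. xhat (r j) - hk (r j) t0 (xhat (r j))) \<longlonglongrightarrow> x0 - h t0 x0"
      by (intro tendsto_diff xhat_r h_conv t0J)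
    then show "uniform_limit J (\<lambda>j t. xhat (r j) - hk (r j) t0 (xhat (r j))) (\<lambda>t. x0 - h t0 x0) sequentially"
      unfolding uniform_limit_iff tendsto_iff by simp
    show "uniform_limit J (\<lambda>j. y (r j)) y' sequentially"
      using y' by (simp add: J_def r_def)
  qed
  have x_eq': "xk (r j) t = w j t + hk (r j) t (xk (r j) t)" if "t \<in> J" for j t
    using x_eq[OF that, of "r j"] by (simp add: w_def algebra_simps)
  obtain x where x: "uniform_limit J (\<lambda>j. xk (r j)) x sequentially"
  proof (rule fixed_points_uniform_limit[OF norm x_eq' w B xB h_lim[OF B]])
    show "nrm (hk (r j) t u - hk (r j) t v) \<le> \<phi> (r j) (nrm (u - v))" if "t \<in> J" for j t u v
      by (rule contr[OF that])
    show "\<exists>\<delta>>0. \<forall>t\<in>{p..d}. \<forall>j. \<phi> (r j) t < t - \<delta>" if "0 < p" "p < d" for p d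
      using I[OF that] by blast
  qed auto
  have x_lim: "(\<lambda>j. xk (r j) t) \<longlonglongrightarrow> x t" if "t \<in> J" for t
    using tendsto_uniform_limitI[OF x that] .
  have w_lim: "(\<lambda>j. w j t) \<longlonglongrightarrow> w' t" if "t \<in> J" for t
    using tendsto_uniform_limitI[OF w that] .
  have x_split: "x t = w' t + h t (x t)" if t: "t \<in> J" for t
  proof (rule LIMSEQ_unique[OF x_lim[OF t]])
    have "(\<lambda>j. w j t + hk (r j) t (xk (r j) t)) \<longlonglongrightarrow> w' t + h t (x t)"
      by (intro tendsto_add w_lim h_conv x_lim t)
    then show "(\<lambda>j. xk (r j) t) \<longlonglongrightarrow> w' t + h t (x t)" using x_eq'[OF t] by simp
  qed
  have xt0: "x t0 = x0" using LIMSEQ_unique[OF x_lim[OF t0J]] xhat_r x_t0 by simp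
  have "regulated_on t0 (t0 + a) x"
    using regulated_uniform_limit[OF x_reg x[unfolded J_def]] .
  \<comment> \<open>The equation exhibits \<open>hk (r j) t (xk (r j) t)\<close> as a difference of uniformly convergent functions.\<close>
  moreover have "regulated_on t0 (t0 + a) (\<lambda>t. h t (x t))"
  proof (rule regulated_uniform_limit[OF hx_reg])
    have "uniform_limit J (\<lambda>j t. xk (r j) t - w j t) (\<lambda>t. x t - w' t) sequentially"
      by (rule uniform_limit_minus[OF x w])
    then show "uniform_limit {t0..t0 + a} (\<lambda>j t. hk (r j) t (xk (r j) t)) (\<lambda>t. h t (x t)) sequentially"
      unfolding J_def[symmetric]
      by (rule uniform_limit_cong'[THEN iffD1, rotated 2])
        (use x_eq' x_split in \<open>auto simp: algebra_simps\<close>)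
  qed
  moreover have "KS_on g (\<lambda>s. f s (x s)) t0 t"
    "x t = x0 - h t0 (x t0) + h t (x t) + KS_int g (\<lambda>s. f s (x s)) t0 t" if t: "t \<in> J" for t
  proof -
    have tt: "t0 \<le> t" "t \<le> t0 + a" using t by (auto simp: J_def)
    have int_t: "KS_on g (\<lambda>s. fk (r j) s (xk (r j) s)) t0 t" for j
      using KS_integrable_subinterval[OF x_int order_refl tt] .
    have lim: "(\<lambda>j. fk (r j) s (xk (r j) s)) \<longlonglongrightarrow> f s (x s)" if "s \<in> {t0..t}" for s
    proof -
      have s: "s \<in> J" using that tt by (auto simp: J_def)
      have "uniform_limit B (\<lambda>j u. fk (r j) s u) (\<lambda>u. f s u) sequentially"
        using s by (intro uniform_limit_subseq[OF iii_f r] B) (simp add: J_def)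
      have "(\<lambda>j. fk (r j) s (xk (r j) s) - f s (xk (r j) s)) \<longlonglongrightarrow> 0"
      proof (rule tendstoI)
        fix e :: real assume "e > 0"
        from uniform_limitD[OF \<open>uniform_limit B _ _ _\<close> this]
        show "\<forall>\<^sub>F j in sequentially. dist (fk (r j) s (xk (r j) s) - f s (xk (r j) s)) 0 < e"
          by eventually_elim (use xB[OF s] in \<open>auto simp: dist_norm\<close>)
      qed
      moreover have "(\<lambda>j. f s (xk (r j) s)) \<longlonglongrightarrow> f s (x s)"
        using continuous_on_tendsto_compose[OF f_cont x_lim[OF s]] s by (simp add: J_def)
      ultimately have "(\<lambda>j. (fk (r j) s (xk (r j) s) - f s (xk (r j) s)) + f s (xk (r j) s)) \<longlonglongrightarrow> 0 + f s (x s)"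
        by (rule tendsto_add)
      then show ?thesis by simp
    qed
    have mono: "mono_on {t0..t} g" using g_mono by (rule mono_on_subset) (use tt in auto)
    have dom: "norm (KS_int g (\<lambda>s. fk (r j) s (xk (r j) s)) u v) \<le> K v - K u"
      if "t0 \<le> u" "u \<le> v" "v \<le> t" for j u v
      using that tt by (intro curve) auto
    note dct = KS_dominated_convergence[where F = "\<lambda>j s. fk (r j) s (xk (r j) s)" and f = "\<lambda>s. f s (x s)",
        OF tt(1) mono int_t dom lim]
    show "KS_on g (\<lambda>s. f s (x s)) t0 t" by (rule dct(1))
    have "(\<lambda>j. y (r j) t) \<longlonglongrightarrow> y' t"
      using tendsto_uniform_limitI[OF y', of t] t by (simp add: r_def J_def)
    with dct(2) have "y' t = KS_int g (\<lambda>s. f s (x s)) t0 t"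
      unfolding y_def using LIMSEQ_unique by blast
    then show "x t = x0 - h t0 (x t0) + h t (x t) + KS_int g (\<lambda>s. f s (x s)) t0 t"
      using x_split[OF t] by (simp add: w'_def xt0 algebra_simps)
  qed
  ultimately have "is_solution nrm g t0 a h f x0 x"
    using xt0 by (auto simp: is_solution_def KS_eq J_def)
  with r x show ?thesis unfolding J_def by blast
qed

end
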